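(* Let $A$ be a subset of a field $\mathbb{F}$ with $k \geq 2$ elements, and let $A \cap (- A) = \varnothing$. (a) Suppose that one of the following conditions is satisfied: (1) $32k^2 - 64k + 31 < p(\mathbb{F})$; (2) $8k - 10 < p(\mathbb{F}) < 32k^2 - 64k + 31$; (3) $8k - 10 < p(\mathbb{F})$ and $p(\mathbb{F}) \equiv \pm 3 \pmod 8$. Then $|4_{\pm}A| \geq 8k - 9$. (b) If $l$ is the least positive integer such that $8k - 10 - 4l < p(\mathbb{F}) < 8k - 10 - 4(l-1)$ and if $p(\mathbb{F}) \equiv \pm 3 \pmod 8$, then $$|4_{\pm}A| \geq 8k - 9 - 4l.$$
   Context: For a field $\mathbb{F}$, $p(\mathbb{F})$ denotes the order of the smallest nontrivial subgroup of the additive group of $\mathbb{F}$, or $\infty$ if there is no such finite subgroup; equivalently, the characteristic of $\mathbb{F}$ if it is positive and $\infty$ if the characteristic is $0$. A congruence condition on $p(\mathbb{F})$ presupposes that it is finite. For a finite set $A=\{a_1,\dots,a_k\}$ with $|A|=k$, write $-A=\{-a:a\in A\}$ and $4_{\pm}A=\{\sum_{i=1}^k\lambda_i a_i:\lambda_i\in\mathbb{Z}\cap[-4,4],\ \sum_{i=1}^k|\lambda_i|=4\}$. *)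

theory Defs
  imports Complex_Main "HOL-Library.Extended_Real" "HOL-Number_Theory.Cong"
begin

definition additive_subgroup :: "'a::ab_group_add set \<Rightarrow> bool" where
  "additive_subgroup H \<longleftrightarrow>
     0 \<in> H \<and> (\<forall>x\<in>H. \<forall>y\<in>H. x + y \<in> H) \<and> (\<forall>x\<in>H. - x \<in> H)"

(* If there is no finite nontrivial subgroup, the infimum of the empty set
   is the top element \<infinity> of enat. *)
definition min_subgroup_order :: "'a::ab_group_add itself \<Rightarrow> enat" where
  "min_subgroup_order _ =
     (INF H \<in> {H :: 'a set. additive_subgroup H \<and> H \<noteq> {0} \<and> finite H}. enat (card H))"

(* Meant for finite A.  The integer coefficients are indexed by the elements of A,
   so no enumeration of A is needed; values of c outside A are irrelevant. *)
definition signed_sumset :: "nat \<Rightarrow> 'a::comm_ring_1 set \<Rightarrow> 'a set" where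
  "signed_sumset h A =
     {\<Sum>a\<in>A. of_int (c a) * a | c :: 'a \<Rightarrow> int.
        (\<forall>a\<in>A. c a \<in> {- int h..int h}) \<and> (\<Sum>a\<in>A. \<bar>c a\<bar>) = int h}"

(* A congruence condition entails that the value is finite. *)
definition pm3_mod8 :: "enat \<Rightarrow> bool" where
  "pm3_mod8 p \<longleftrightarrow>
     (\<exists>n::nat. p = enat n \<and> ([int n = 3] (mod 8) \<or> [int n = - 3] (mod 8)))"

(* The bounds may be negative, so they are compared with p as extended reals
   rather than with truncated subtraction. *)
definition in_window :: "nat \<Rightarrow> nat \<Rightarrow> enat \<Rightarrow> bool" where
  "in_window k l p \<longleftrightarrow>
     ereal (8 * real k - 10 - 4 * real l) < ereal_of_enat p \<and>
     ereal_of_enat p < ereal (8 * real k - 10 - 4 * (real l - 1))"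

end

theory Submission
  imports Defs "HOL-Computational_Algebra.Polynomial" "HOL-Computational_Algebra.Primes"
    "HOL-Library.FuncSet"
begin

text \<open>
  Let \<open>B = A \<union> - A\<close>, a symmetric set of \<open>2 k\<close> nonzero elements. A sum of four elements of
  \<open>B\<close>, no two of them opposite, belongs to the signed sumset, so it is enough to bound the number
  of such sums from below, and one may restrict the summands to a subset \<open>X\<close> of \<open>B\<close>. Only the
  characteristic \<open>p\<close> matters, because it is the least order of a nontrivial finite additive
  subgroup (or there is none, in characteristic 0).

  The bound comes from the polynomial argument of Alon, Nathanson and Ruzsa. Let \<open>X\<close> have
  \<open>m = c + 1\<close> elements and let \<open>V\<close> be the product of the six pair sums \<open>x\<^sub>i + x\<^sub>j\<close>; it vanishes
  exactly on the quadruples with two opposite entries. If there were at most \<open>L = 4 m - 10\<close> sums,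
  a monic polynomial \<open>P\<close> of degree \<open>L\<close> would vanish on all of them, and
  \<open>V \<cdot> P(x\<^sub>1 + x\<^sub>2 + x\<^sub>3 + x\<^sub>4)\<close>, of degree \<open>L + 6 = 4 c\<close>, would vanish on \<open>X\<^sup>4\<close>. Taking
  divided differences over \<open>X\<close> in each variable shows that its coefficient at
  \<open>(x\<^sub>1 x\<^sub>2 x\<^sub>3 x\<^sub>4)\<^sup>c\<close> is 0. That coefficient is \<open>L! / c!\<^sup>4\<close> times
  \<open>8 c\<^sup>3 (c - 1) (8 (c - 1)\<^sup>2 - 1)\<close>, and for \<open>p > L\<close> only the last factor can be divisible by \<open>p\<close>
  (\<open>card_noncancelling_sums_generic\<close>).

  In part (b) take \<open>m = 2 k - l\<close>. The window and the parity of \<open>p\<close> leave \<open>p = 4 (m - 2) \<plusminus> 1\<close>, and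
  then \<open>2 (8 (m - 2)\<^sup>2 - 1) = (4 (m - 2))\<^sup>2 - 1 - 1\<close> is \<open>- 1\<close> modulo \<open>p\<close>. In part (a) take \<open>X = B\<close>.
  Each of the three conditions gives \<open>8 k - 10 < p\<close> and \<open>p \<noteq> 32 (k - 1)\<^sup>2 - 1\<close> (the right-hand side
  is 7 modulo 8), so the argument applies unless \<open>p\<close> is a proper divisor of \<open>32 (k - 1)\<^sup>2 - 1\<close>. Such
  \<open>p\<close> do exist, for example \<open>k = 4\<close> and \<open>p = 41\<close>.

  For these \<open>p\<close> one has to look below the leading term (\<open>card_noncancelling_sums_residual\<close>). Write
  \<open>k = n + 1\<close>. The divided differences \<open>H\<^sub>i\<close> of \<open>x\<^sup>i\<close> over \<open>B\<close> vanish for \<open>i < c\<close>, and \<open>H\<^sub>c = 1\<close>;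
  let \<open>H\<^bsub>c + g\<^esub>\<close> be the next one that is nonzero. By symmetry \<open>g\<close> is even, and \<open>g \<le> c + 1\<close> because
  \<open>0 \<notin> B\<close>. Choose \<open>P\<close> even, and multiply \<open>V P\<close> by \<open>x\<^sub>1\<^sup>a\<close> and a power of the sum.
  Up to excess degree \<open>g - 1\<close> this forces
  the coefficients of \<open>P\<close> just below its leading one to vanish; at excess degree \<open>g\<close> it yields for
  each \<open>a \<le> g\<close> one linear relation between \<open>H\<^bsub>c + g\<^esub>\<close> and a single unknown coefficient \<open>E\<close> of \<open>P\<close>
  (\<open>gap_relation\<close>). These relations are incompatible, and the reason depends on the size of \<open>g\<close>,
  because the factor \<open>(L + g - a)!\<close> in them is 0 exactly when \<open>L + g - a \<ge> p\<close>. As \<open>L + g\<close> is even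
  and \<open>p\<close> is odd, there are three cases. If \<open>L + g < p\<close>, the case
  \<open>a = 0\<close> determines \<open>g\<close> modulo \<open>p\<close> in terms of \<open>n\<close>, and eliminating \<open>E\<close> among \<open>a = 2, 3, 4\<close> leaves
  constants that no such \<open>p\<close> divides simultaneously. If \<open>L + g = p + 1\<close>, then \<open>g\<close> is again known
  modulo \<open>p\<close>, and \<open>a = 2, 3\<close> suffice. If \<open>L + g \<ge> p + 2\<close>, the case \<open>a = 2\<close> gives \<open>E = 0\<close>, and the
  relations for the many larger \<open>a\<close> become a first-order recurrence between two cubic polynomials,
  which has no solution.
\<close>

section \<open>Factorials in a field of large characteristic\<close>

definition char_above :: "'a::field itself \<Rightarrow> nat \<Rightarrow> bool" where
  "char_above _ N \<longleftrightarrow> (\<forall>i. 0 < i \<and> i \<le> N \<longrightarrow> of_nat i \<noteq> (0::'a))"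

lemma char_aboveD:
  "char_above TYPE('a::field) N \<Longrightarrow> 0 < i \<Longrightarrow> i \<le> N \<Longrightarrow> of_nat i \<noteq> (0::'a)"
  by (simp add: char_above_def)

lemma char_above_mono:
  "char_above TYPE('a::field) N \<Longrightarrow> M \<le> N \<Longrightarrow> char_above TYPE('a) M"
  by (auto simp: char_above_def)

lemma of_nat_fact_nonzero:
  assumes "char_above TYPE('a::field) N" "i \<le> N"
  shows "of_nat (fact i) \<noteq> (0::'a)"
  using assms(2)
proof (induction i)
  case (Suc i)
  have "of_nat (Suc i) \<noteq> (0::'a)"
    using char_aboveD[OF assms(1), of "Suc i"] Suc.prems by simp
  moreover have "of_nat (fact (Suc i)) = (of_nat (Suc i) * of_nat (fact i) :: 'a)"
    by (simp only: fact_Suc of_nat_mult of_nat_id)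
  ultimately show ?case using Suc by simp
qed simp

text \<open>The value 0 at negative arguments makes \<open>inv_fact (z - 1) = z \<cdot> inv_fact z\<close> hold for all
  integers below the characteristic, so multinomial coefficients need no case distinction.\<close>

definition inv_fact :: "int \<Rightarrow> 'a::field" where
  "inv_fact z = (if z < 0 then 0 else inverse (of_nat (fact (nat z))))"

lemma inv_fact_0 [simp]: "inv_fact 0 = 1"
  by (simp add: inv_fact_def)

lemma inv_fact_neg [simp]: "z < 0 \<Longrightarrow> inv_fact z = 0"
  by (simp add: inv_fact_def)

lemma inv_fact_nonzero:
  assumes "char_above TYPE('a::field) N" "0 \<le> z" "z \<le> int N"
  shows "inv_fact z \<noteq> (0::'a)"
  using of_nat_fact_nonzero[OF assms(1), of "nat z"] assms(2,3)
  by (simp add: inv_fact_def del: of_nat_fact)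

lemma inv_fact_pred:
  assumes "char_above TYPE('a::field) N" "z \<le> int N"
  shows "inv_fact (z - 1) = of_int z * (inv_fact z :: 'a)"
proof (cases "z \<le> 0")
  case True
  then show ?thesis by (cases "z = 0") (auto simp: inv_fact_def)
next
  case False
  define i where "i = nat (z - 1)"
  have z: "z = int (Suc i)" using False by (simp add: i_def)
  have nz: "of_nat (Suc i) \<noteq> (0::'a)"
    using char_aboveD[OF assms(1), of "Suc i"] assms(2) z by simp
  have "inv_fact z = inverse (of_nat (Suc i)) * (inv_fact (int i) :: 'a)"
  proof -
    have "of_nat (fact (Suc i)) = (of_nat (Suc i) * of_nat (fact i) :: 'a)"
      by (simp only: fact_Suc of_nat_mult of_nat_id)
    then show ?thesis unfolding z inv_fact_def
      by (simp only: nat_int) (simp del: of_nat_Suc fact_Suc)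
  qed
  then have "of_int z * inv_fact z = (inv_fact (int i) :: 'a)"
    using nz unfolding z by (simp add: mult.assoc[symmetric] del: of_nat_Suc)
  moreover have "z - 1 = int i" using z by simp
  ultimately show ?thesis by simp
qed

text \<open>Dividing a monomial out of a power of the sum replaces \<open>1 / z!\<close> by \<open>1 / (z - i)!\<close>, that is, it
  multiplies by this factor.\<close>

definition falling :: "'a::comm_ring_1 \<Rightarrow> nat \<Rightarrow> 'a" where
  "falling z i = (\<Prod>t<i. z - of_nat t)"

lemma inv_fact_diff:
  assumes "char_above TYPE('a::field) N" "z \<le> int N"
  shows "inv_fact (z - int i) = falling (of_int z) i * (inv_fact z :: 'a)"
proof (induction i)
  case (Suc i)
  have "inv_fact (z - int (Suc i)) = of_int (z - int i) * (inv_fact (z - int i) :: 'a)"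
    using inv_fact_pred[OF assms(1), of "z - int i"] assms(2) by (simp add: algebra_simps)
  with Suc show ?case by (simp add: falling_def algebra_simps)
qed (simp add: falling_def)

section \<open>The product of the pair sums\<close>

definition pair_prod :: "'a::comm_ring_1 \<Rightarrow> 'a \<Rightarrow> 'a \<Rightarrow> 'a \<Rightarrow> 'a" where
  "pair_prod x1 x2 x3 x4 =
     (x1 + x2) * (x1 + x3) * (x1 + x4) * (x2 + x3) * (x2 + x4) * (x3 + x4)"

text \<open>The expansion of \<open>pair_prod\<close>: a coefficient followed by the four exponents. Its coefficients are
  those of the Schur polynomial of the partition \<open>(3, 2, 1, 0)\<close>.\<close>

definition pair_mons :: "(nat \<times> nat \<times> nat \<times> nat \<times> nat) list" where
  "pair_mons = [
     (1,0,1,2,3), (1,0,1,3,2), (1,0,2,1,3), (2,0,2,2,2), (1,0,2,3,1), (1,0,3,1,2),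
     (1,0,3,2,1), (1,1,0,2,3), (1,1,0,3,2), (2,1,1,1,3), (4,1,1,2,2), (2,1,1,3,1),
     (1,1,2,0,3), (4,1,2,1,2), (4,1,2,2,1), (1,1,2,3,0), (1,1,3,0,2), (2,1,3,1,1),
     (1,1,3,2,0), (1,2,0,1,3), (2,2,0,2,2), (1,2,0,3,1), (1,2,1,0,3), (4,2,1,1,2),
     (4,2,1,2,1), (1,2,1,3,0), (2,2,2,0,2), (4,2,2,1,1), (2,2,2,2,0), (1,2,3,0,1),
     (1,2,3,1,0), (1,3,0,1,2), (1,3,0,2,1), (1,3,1,0,2), (2,3,1,1,1), (1,3,1,2,0),
     (1,3,2,0,1), (1,3,2,1,0)]"

lemma falling_numerals [simp]:
  "falling z 0 = 1" "falling z (Suc 0) = z" "falling z 1 = z" "falling z 2 = z * (z - 1)"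
  "falling z 3 = z * (z - 1) * (z - 2)"
  by (simp_all add: falling_def numeral_2_eq_2 numeral_3_eq_3)

lemma pair_prod_expand:
  "pair_prod x1 x2 x3 x4 =
     (\<Sum>(k, i, j, l, q) \<leftarrow> pair_mons. of_nat k * (x1 ^ i * x2 ^ j * x3 ^ l * x4 ^ q))"
  unfolding pair_prod_def pair_mons_def
  by (simp add: algebra_simps power2_eq_square power3_eq_cube)

lemma pair_mons_degree:
  "(k, i, j, l, q) \<in> set pair_mons \<Longrightarrow> i + j + l + q = 6"
  by (auto simp: pair_mons_def)

text \<open>If \<open>z\<^sub>1 + z\<^sub>2 + z\<^sub>3 + z\<^sub>4 = K + 6\<close>, the coefficient of \<open>x\<^sub>1\<^bsup>z1\<^esup> x\<^sub>2\<^bsup>z2\<^esup> x\<^sub>3\<^bsup>z3\<^esup> x\<^sub>4\<^bsup>z4\<^esup>\<close> in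
  \<open>pair_prod \<cdot> (x\<^sub>1 + x\<^sub>2 + x\<^sub>3 + x\<^sub>4)\<^sup>K\<close> is \<open>K! / (z\<^sub>1! z\<^sub>2! z\<^sub>3! z\<^sub>4!)\<close> times this polynomial.\<close>

definition top_coeff :: "'a::comm_ring_1 \<Rightarrow> 'a \<Rightarrow> 'a \<Rightarrow> 'a \<Rightarrow> 'a" where
  "top_coeff z1 z2 z3 z4 =
     (\<Sum>(k, i, j, l, q) \<leftarrow> pair_mons.
        of_nat k * (falling z1 i * falling z2 j * falling z3 l * falling z4 q))"

lemma top_coeff_diag:
  "top_coeff c c c c = 8 * c ^ 3 * (c - 1) * (8 * (c - 1)\<^sup>2 - 1)"
  unfolding top_coeff_def pair_mons_def
  by (simp add: algebra_simps power2_eq_square power3_eq_cube)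

text \<open>Each variable occurs in only three of the six pair sums.\<close>

lemma top_coeff_cubic:
  "\<exists>q0 q1 q2 q3. \<forall>z1. top_coeff z1 z2 z3 z4 = q0 + q1 * z1 + q2 * z1 ^ 2 + q3 * z1 ^ 3"
proof -
  have f: "\<exists>q0 q1 q2 q3. \<forall>z1. falling z1 i = q0 + q1 * z1 + q2 * z1 ^ 2 + q3 * z1 ^ (3::nat)"
    if "i \<le> 3" for i :: nat
  proof -
    have "i = 0 \<or> i = 1 \<or> i = 2 \<or> i = 3" using that by arith
    then consider "i = 0" | "i = 1" | "i = 2" | "i = 3" by blast
    then show ?thesis
    proof cases
      case 1 show ?thesis unfolding 1 by (rule exI[of _ 1], rule exI[of _ 0], rule exI[of _ 0], rule exI[of _ 0]) simp
    next
      case 2 show ?thesis unfolding 2 by (rule exI[of _ 0], rule exI[of _ 1], rule exI[of _ 0], rule exI[of _ 0]) simp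
    next
      case 3 show ?thesis unfolding 3 by (rule exI[of _ 0], rule exI[of _ "-1"], rule exI[of _ 1], rule exI[of _ 0]) (simp add: algebra_simps power2_eq_square)
    next
      case 4 show ?thesis unfolding 4 by (rule exI[of _ 0], rule exI[of _ 2], rule exI[of _ "-3"], rule exI[of _ 1]) (simp add: algebra_simps power2_eq_square power3_eq_cube)
    qed
  qed
  have "\<exists>q0 q1 q2 q3. \<forall>z1. (\<Sum>(k, i, j, l, q) \<leftarrow> ms.
        of_nat k * (falling z1 i * falling z2 j * falling z3 l * falling z4 q)) =
         q0 + q1 * z1 + q2 * z1 ^ 2 + q3 * z1 ^ (3::nat)"
    if "\<forall>(k, i, j, l, q) \<in> set ms. i \<le> 3" for ms :: "(nat \<times> nat \<times> nat \<times> nat \<times> nat) list"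
    using that
  proof (induction ms)
    case Nil
    then show ?case by (intro exI[of _ 0]) simp
  next
    case (Cons t ms)
    obtain k i j l q where t: "t = (k, i, j, l, q)" by (cases t)
    obtain q0 q1 q2 q3 where 1: "\<And>z1. (\<Sum>(k, i, j, l, q) \<leftarrow> ms.
        of_nat k * (falling z1 i * falling z2 j * falling z3 l * falling z4 q)) =
         q0 + q1 * z1 + q2 * z1 ^ 2 + q3 * z1 ^ (3::nat)"
      using Cons by auto
    obtain r0 r1 r2 r3 where 2: "\<And>z1::'a. falling z1 i = r0 + r1 * z1 + r2 * z1 ^ 2 + r3 * z1 ^ (3::nat)"
      using f[of i] Cons.prems t by auto
    define w where "w = of_nat k * (falling z2 j * falling z3 l * falling z4 q)"
    show ?case
      by (rule exI[of _ "q0 + w * r0"], rule exI[of _ "q1 + w * r1"],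
          rule exI[of _ "q2 + w * r2"], rule exI[of _ "q3 + w * r3"])
         (simp only: t list.map sum_list.Cons prod.case 1 2, simp add: w_def algebra_simps)
  qed
  from this[of pair_mons] show ?thesis
    unfolding top_coeff_def by (auto simp: pair_mons_def)
qed

lemma top_coeff_swap:
  "top_coeff z1 z3 z2 z4 = top_coeff z1 z2 z3 z4"
  "top_coeff z1 z4 z3 z2 = top_coeff z1 z2 z3 z4"
  "top_coeff z2 z1 z3 z4 = top_coeff z1 z2 z3 z4"
  unfolding top_coeff_def pair_mons_def
  by (simp_all add: add_ac mult_ac del: falling_numerals)

section \<open>Divided differences on a finite set of nodes\<close>

text \<open>The sum \<open>\<Sum>b\<in>X. weight b * f b\<close> is the divided difference of \<open>f\<close> over the \<open>c + 1\<close> nodes \<open>X\<close>, and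
  \<open>moment (c + j)\<close> is the complete homogeneous symmetric polynomial of degree \<open>j\<close> in the nodes.\<close>

locale nodes =
  fixes X :: "'a::field set" and c :: nat
  assumes fin [simp]: "finite X" and card_X: "card X = Suc c"
begin

definition weight :: "'a \<Rightarrow> 'a" where
  "weight b = inverse (\<Prod>b'\<in>X - {b}. b - b')"

definition moment :: "nat \<Rightarrow> 'a" where
  "moment i = (\<Sum>b\<in>X. weight b * b ^ i)"

text \<open>Both sides are read off from the Lagrange interpolation polynomial of \<open>f\<close> at the nodes.\<close>

lemma coeff_eq_divided_difference:
  assumes "degree f \<le> c"
  shows "coeff f c = (\<Sum>b\<in>X. weight b * poly f b)"
proof -
  define N where "N b = (\<Prod>b'\<in>X - {b}. [:- b', 1:])" for b
  have degN: "degree (N b) = c" if "b \<in> X" for b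
    unfolding N_def using that card_X by (subst degree_prod_eq_sum_degree) auto
  have leadN: "coeff (N b) c = 1" if "b \<in> X" for b
  proof -
    have "lead_coeff (N b) = 1" unfolding N_def by (simp add: lead_coeff_prod)
    with degN[OF that] show ?thesis by simp
  qed
  define R where "R = (\<Sum>b\<in>X. smult (weight b * poly f b) (N b))"
  have degR: "degree R \<le> c"
    unfolding R_def by (rule degree_sum_le) (use degN in \<open>auto intro: order.trans[OF degree_smult_le]\<close>)
  have valN: "poly (N b) b' = (if b' = b then inverse (weight b) else 0)"
    if "b \<in> X" "b' \<in> X" for b b'
    using that by (auto simp: N_def poly_prod weight_def)
  have nz: "weight b \<noteq> 0" if "b \<in> X" for b
    using that by (auto simp: weight_def)
  have "poly R b' = poly f b'" if "b' \<in> X" for b'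
  proof -
    have "poly R b' = (\<Sum>b\<in>X. if b = b' then poly f b else 0)"
      unfolding R_def poly_sum using that nz by (intro sum.cong) (auto simp: valN)
    then show ?thesis using that by simp
  qed
  then have sub: "X \<subseteq> {x. poly (f - R) x = 0}" by auto
  have deg: "degree (f - R) \<le> c" using assms degR by (rule degree_diff_le)
  have "f - R = 0"
  proof (rule ccontr)
    assume nz: "f - R \<noteq> 0"
    have "card X \<le> card {x. poly (f - R) x = 0}"
      by (rule card_mono[OF poly_roots_finite[OF nz] sub])
    also have "\<dots> \<le> degree (f - R)" by (rule card_poly_roots_bound[OF nz])
    finally show False using deg card_X by simp
  qed
  then have "coeff f c = coeff R c" by simp
  also have "\<dots> = (\<Sum>b\<in>X. weight b * poly f b)"
    unfolding R_def by (simp add: coeff_sum leadN)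
  finally show ?thesis .
qed

lemma moment_low: "i < c \<Longrightarrow> moment i = 0"
  using coeff_eq_divided_difference[of "monom 1 i"]
  by (simp add: moment_def poly_monom degree_monom_eq)

lemma moment_top: "moment c = 1"
  using coeff_eq_divided_difference[of "monom 1 c"]
  by (simp add: moment_def poly_monom degree_monom_eq)

text \<open>The divided difference in each of four variables; on a product of functions of one variable it is
  the product of the four divided differences.\<close>

definition \<Phi> :: "('a \<Rightarrow> 'a \<Rightarrow> 'a \<Rightarrow> 'a \<Rightarrow> 'a) \<Rightarrow> 'a" where
  "\<Phi> F = (\<Sum>x1\<in>X. \<Sum>x2\<in>X. \<Sum>x3\<in>X. \<Sum>x4\<in>X.
            weight x1 * weight x2 * weight x3 * weight x4 * F x1 x2 x3 x4)"

lemma \<Phi>_add: "\<Phi> (\<lambda>x1 x2 x3 x4. F x1 x2 x3 x4 + G x1 x2 x3 x4) = \<Phi> F + \<Phi> G"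
  unfolding \<Phi>_def by (simp add: algebra_simps sum.distrib)

lemma \<Phi>_cmult: "\<Phi> (\<lambda>x1 x2 x3 x4. r * F x1 x2 x3 x4) = r * \<Phi> F"
  unfolding \<Phi>_def by (simp add: sum_distrib_left mult_ac)

lemma \<Phi>_zero: "\<Phi> (\<lambda>x1 x2 x3 x4. 0) = 0"
  by (simp add: \<Phi>_def)

lemma \<Phi>_sum:
  "finite I \<Longrightarrow> \<Phi> (\<lambda>x1 x2 x3 x4. \<Sum>i\<in>I. F i x1 x2 x3 x4) = (\<Sum>i\<in>I. \<Phi> (F i))"
  by (induction I rule: finite_induct) (simp_all add: \<Phi>_zero \<Phi>_add)

lemma \<Phi>_cong:
  assumes "\<And>x1 x2 x3 x4. x1 \<in> X \<Longrightarrow> x2 \<in> X \<Longrightarrow> x3 \<in> X \<Longrightarrow> x4 \<in> X \<Longrightarrow>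
             F x1 x2 x3 x4 = G x1 x2 x3 x4"
  shows "\<Phi> F = \<Phi> G"
  unfolding \<Phi>_def by (intro sum.cong refl) (simp add: assms)

definition \<mu> :: "nat \<Rightarrow> nat \<Rightarrow> nat \<Rightarrow> nat \<Rightarrow> nat \<Rightarrow> 'a" where
  "\<mu> K i1 i2 i3 i4 =
     \<Phi> (\<lambda>x1 x2 x3 x4. x1 ^ i1 * x2 ^ i2 * x3 ^ i3 * x4 ^ i4 * (x1 + x2 + x3 + x4) ^ K)"

lemma \<mu>_0: "\<mu> 0 i1 i2 i3 i4 = moment i1 * moment i2 * moment i3 * moment i4"
proof -
  have "\<mu> 0 i1 i2 i3 i4 = (\<Sum>x1\<in>X. \<Sum>x2\<in>X. \<Sum>x3\<in>X. \<Sum>x4\<in>X.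
     (weight x1 * x1 ^ i1) * ((weight x2 * x2 ^ i2) * ((weight x3 * x3 ^ i3) * (weight x4 * x4 ^ i4))))"
    unfolding \<mu>_def \<Phi>_def by (simp add: mult_ac)
  also have "\<dots> = moment i1 * (moment i2 * (moment i3 * moment i4))"
    unfolding moment_def by (simp only: sum_distrib_left[symmetric] sum_distrib_right[symmetric])
  finally show ?thesis by (simp add: mult.assoc)
qed

lemma \<mu>_Suc:
  "\<mu> (Suc K) i1 i2 i3 i4 =
     \<mu> K (Suc i1) i2 i3 i4 + \<mu> K i1 (Suc i2) i3 i4 + \<mu> K i1 i2 (Suc i3) i4 + \<mu> K i1 i2 i3 (Suc i4)"
  unfolding \<mu>_def \<Phi>_add[symmetric] by (rule \<Phi>_cong) (simp add: algebra_simps)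

lemma \<mu>_low: "K + i1 + i2 + i3 + i4 < 4 * c \<Longrightarrow> \<mu> K i1 i2 i3 i4 = 0"
proof (induction K arbitrary: i1 i2 i3 i4)
  case 0
  then have "i1 < c \<or> i2 < c \<or> i3 < c \<or> i4 < c" by linarith
  then show ?case by (auto simp: \<mu>_0 moment_low)
qed (simp add: \<mu>_Suc)

definition inv_facts :: "int \<Rightarrow> int \<Rightarrow> int \<Rightarrow> int \<Rightarrow> 'a" where
  "inv_facts z1 z2 z3 z4 = inv_fact z1 * inv_fact z2 * inv_fact z3 * inv_fact z4"

lemma inv_facts_zero_sum:
  assumes "z1 + z2 + z3 + z4 = 0"
  shows "inv_facts z1 z2 z3 z4 = (if z1 = 0 \<and> z2 = 0 \<and> z3 = 0 \<and> z4 = 0 then 1 else 0)"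
proof (cases "z1 < 0 \<or> z2 < 0 \<or> z3 < 0 \<or> z4 < 0")
  case True
  then show ?thesis by (auto simp: inv_facts_def)
next
  case False
  then have "z1 = 0 \<and> z2 = 0 \<and> z3 = 0 \<and> z4 = 0" using assms by linarith
  then show ?thesis by (simp add: inv_facts_def)
qed

lemma inv_facts_step:
  assumes "char_above TYPE('a) N" "z1 \<le> int N" "z2 \<le> int N" "z3 \<le> int N" "z4 \<le> int N"
    and "z1 + z2 + z3 + z4 = int (Suc K)"
  shows "of_nat (fact K) * (inv_facts (z1 - 1) z2 z3 z4 + inv_facts z1 (z2 - 1) z3 z4 +
           inv_facts z1 z2 (z3 - 1) z4 + inv_facts z1 z2 z3 (z4 - 1)) =
         of_nat (fact (Suc K)) * inv_facts z1 z2 z3 z4"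
proof -
  have "of_nat (Suc K) = (of_int (z1 + z2 + z3 + z4) :: 'a)"
    unfolding assms(6) by simp
  moreover have "of_nat (fact (Suc K)) = (of_nat (Suc K) * of_nat (fact K) :: 'a)"
    by (simp only: fact_Suc of_nat_mult of_nat_id)
  ultimately show ?thesis
    unfolding inv_facts_def
    by (simp only: inv_fact_pred[OF assms(1,2)] inv_fact_pred[OF assms(1,3)]
        inv_fact_pred[OF assms(1,4)] inv_fact_pred[OF assms(1,5)])
       (simp add: algebra_simps del: of_nat_fact)
qed

text \<open>In total degree \<open>4 c\<close> only the monomial \<open>(x\<^sub>1 x\<^sub>2 x\<^sub>3 x\<^sub>4)\<^sup>c\<close> has a nonzero value, namely 1, so \<open>\<Phi>\<close>
  extracts its multinomial coefficient. Induction on \<open>K\<close> replaces the multinomial theorem: removing one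
  factor of the sum from \<open>\<mu>\<close> corresponds to \<open>inv_facts_step\<close>.\<close>

lemma \<mu>_at:
  assumes "char_above TYPE('a) c" "K + i1 + i2 + i3 + i4 = 4 * c"
  shows "\<mu> K i1 i2 i3 i4 = of_nat (fact K) *
           inv_facts (int c - int i1) (int c - int i2) (int c - int i3) (int c - int i4)"
  using assms(2)
proof (induction K arbitrary: i1 i2 i3 i4)
  case 0
  then consider "i1 < c \<or> i2 < c \<or> i3 < c \<or> i4 < c" | "i1 = c \<and> i2 = c \<and> i3 = c \<and> i4 = c"
    by linarith
  then show ?case
  proof cases
    case 1
    then have "\<mu> 0 i1 i2 i3 i4 = 0" by (auto simp: \<mu>_0 moment_low)
    then show ?thesis using 1 0 by (subst inv_facts_zero_sum) auto
  next
    case 2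
    then show ?thesis by (simp add: \<mu>_0 moment_top inv_facts_zero_sum)
  qed
next
  case (Suc K)
  have e: "int c - int (Suc i) = int c - int i - 1" for i by simp
  have s: "K + Suc i1 + i2 + i3 + i4 = 4 * c" "K + i1 + Suc i2 + i3 + i4 = 4 * c"
    "K + i1 + i2 + Suc i3 + i4 = 4 * c" "K + i1 + i2 + i3 + Suc i4 = 4 * c"
    using Suc.prems by simp_all
  show ?case
    unfolding \<mu>_Suc Suc.IH[OF s(1)] Suc.IH[OF s(2)] Suc.IH[OF s(3)] Suc.IH[OF s(4)] e
      distrib_left[symmetric]
    by (rule inv_facts_step[OF assms(1)]) (use Suc.prems in auto)
qed

end

text \<open>Nodes whose moments vanish strictly between \<open>c\<close> and \<open>c + g\<close>. For total degrees up to \<open>4 c + g\<close> the only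
  monomials on which \<open>\<Phi>\<close> is nonzero are \<open>(x\<^sub>1 x\<^sub>2 x\<^sub>3 x\<^sub>4)\<^sup>c\<close> and its four multiples by some \<open>x\<^sub>i\<^sup>g\<close>.\<close>

locale gapped_nodes = nodes +
  fixes g :: nat
  assumes g_pos: "0 < g" and gap: "\<And>j. 0 < j \<Longrightarrow> j < g \<Longrightarrow> moment (c + j) = 0"
begin

lemma moment_cases: "moment i = 0 \<or> i = c \<or> i \<ge> c + g"
  using moment_low[of i] gap[of "i - c"] by force

lemma \<mu>_gap_zero:
  assumes "4 * c < K + i1 + i2 + i3 + i4" "K + i1 + i2 + i3 + i4 < 4 * c + g"
  shows "\<mu> K i1 i2 i3 i4 = 0"
  using assms
proof (induction K arbitrary: i1 i2 i3 i4)
  case 0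
  have "moment i1 = 0 \<or> moment i2 = 0 \<or> moment i3 = 0 \<or> moment i4 = 0"
    using moment_cases[of i1] moment_cases[of i2] moment_cases[of i3] moment_cases[of i4] 0
    by linarith
  then show ?case by (auto simp: \<mu>_0)
qed (simp add: \<mu>_Suc)

definition gap_facts :: "int \<Rightarrow> int \<Rightarrow> int \<Rightarrow> int \<Rightarrow> 'a" where
  "gap_facts z1 z2 z3 z4 =
     inv_facts (z1 + int g) z2 z3 z4 + inv_facts z1 (z2 + int g) z3 z4 +
     inv_facts z1 z2 (z3 + int g) z4 + inv_facts z1 z2 z3 (z4 + int g)"

lemma \<mu>_gap:
  assumes "char_above TYPE('a) (c + g)" "K + i1 + i2 + i3 + i4 = 4 * c + g"
  shows "\<mu> K i1 i2 i3 i4 = moment (c + g) * of_nat (fact K) *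
           gap_facts (int c - int i1) (int c - int i2) (int c - int i3) (int c - int i4)"
  using assms(2)
proof (induction K arbitrary: i1 i2 i3 i4)
  case 0
  define E where "E = (\<lambda>i1 i2 i3 i4 :: nat. i1 = c + g \<and> i2 = c \<and> i3 = c \<and> i4 = c)"
  have g: "gap_facts (int c - int i1) (int c - int i2) (int c - int i3) (int c - int i4) =
     (if E i1 i2 i3 i4 then 1 else 0) + (if E i2 i1 i3 i4 then 1 else 0) +
     (if E i3 i1 i2 i4 then 1 else 0) + (if E i4 i1 i2 i3 then 1 else 0)"
    unfolding gap_facts_def E_def using 0
    by (subst (1 2 3 4) inv_facts_zero_sum) (auto intro!: arg_cong2[where f = "(+)"])
  show ?case
  proof (cases "E i1 i2 i3 i4 \<or> E i2 i1 i3 i4 \<or> E i3 i1 i2 i4 \<or> E i4 i1 i2 i3")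
    case True
    then show ?thesis unfolding g using g_pos by (auto simp: E_def \<mu>_0 moment_top)
  next
    case False
    have "moment i1 = 0 \<or> moment i2 = 0 \<or> moment i3 = 0 \<or> moment i4 = 0"
    proof (rule ccontr)
      assume "\<not> ?thesis"
      then have "i1 = c \<or> c + g \<le> i1" "i2 = c \<or> c + g \<le> i2" "i3 = c \<or> c + g \<le> i3"
        "i4 = c \<or> c + g \<le> i4"
        using moment_cases by blast+
      then have "E i1 i2 i3 i4 \<or> E i2 i1 i3 i4 \<or> E i3 i1 i2 i4 \<or> E i4 i1 i2 i3"
        unfolding E_def using 0 g_pos by (elim disjE) simp_all
      with False show False by blast
    qed
    then show ?thesis unfolding g using False by (auto simp: \<mu>_0)
  qed
next
  case (Suc K)
  have e: "int c - int (Suc i) = int c - int i - 1" for i by simp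
  have s: "K + Suc i1 + i2 + i3 + i4 = 4 * c + g" "K + i1 + Suc i2 + i3 + i4 = 4 * c + g"
    "K + i1 + i2 + Suc i3 + i4 = 4 * c + g" "K + i1 + i2 + i3 + Suc i4 = 4 * c + g"
    using Suc.prems by simp_all
  let ?z = "\<lambda>i. int c - int i"
  note st = inv_facts_step[OF assms(1), where K = K]
  note st1 = st[of "?z i1 + int g" "?z i2" "?z i3" "?z i4"]
  note st2 = st[of "?z i1" "?z i2 + int g" "?z i3" "?z i4"]
  note st3 = st[of "?z i1" "?z i2" "?z i3 + int g" "?z i4"]
  note st4 = st[of "?z i1" "?z i2" "?z i3" "?z i4 + int g"]
  have side: "?z i \<le> int (c + g)" "?z i + int g \<le> int (c + g)" for i by simp_all
  have tot: "?z i1 + int g + ?z i2 + ?z i3 + ?z i4 = int (Suc K)"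
    "?z i1 + (?z i2 + int g) + ?z i3 + ?z i4 = int (Suc K)"
    "?z i1 + ?z i2 + (?z i3 + int g) + ?z i4 = int (Suc K)"
    "?z i1 + ?z i2 + ?z i3 + (?z i4 + int g) = int (Suc K)"
    using Suc.prems by simp_all
  note st1 = st1[OF side(2) side(1) side(1) side(1) tot(1)]
  note st2 = st2[OF side(1) side(2) side(1) side(1) tot(2)]
  note st3 = st3[OF side(1) side(1) side(2) side(1) tot(3)]
  note st4 = st4[OF side(1) side(1) side(1) side(2) tot(4)]
  have "of_nat (fact K) * (gap_facts (?z i1 - 1) (?z i2) (?z i3) (?z i4) +
          gap_facts (?z i1) (?z i2 - 1) (?z i3) (?z i4) +
          gap_facts (?z i1) (?z i2) (?z i3 - 1) (?z i4) +
          gap_facts (?z i1) (?z i2) (?z i3) (?z i4 - 1)) =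
        of_nat (fact (Suc K)) * gap_facts (?z i1) (?z i2) (?z i3) (?z i4)" (is "?l = ?r")
  proof -
    have c: "z - 1 + int g = z + int g - 1" for z by simp
    have "?r = of_nat (fact (Suc K)) * inv_facts (?z i1 + int g) (?z i2) (?z i3) (?z i4) +
       of_nat (fact (Suc K)) * inv_facts (?z i1) (?z i2 + int g) (?z i3) (?z i4) +
       of_nat (fact (Suc K)) * inv_facts (?z i1) (?z i2) (?z i3 + int g) (?z i4) +
       of_nat (fact (Suc K)) * inv_facts (?z i1) (?z i2) (?z i3) (?z i4 + int g)"
      unfolding gap_facts_def distrib_left ..
    also have "\<dots> = ?l"
      unfolding st1[symmetric] st2[symmetric] st3[symmetric] st4[symmetric] gap_facts_def c
      by (simp only: distrib_left add_ac)
    finally show ?thesis by simp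
  qed
  then show ?case
    unfolding \<mu>_Suc Suc.IH[OF s(1)] Suc.IH[OF s(2)] Suc.IH[OF s(3)] Suc.IH[OF s(4)] e
      distrib_left[symmetric]
    by (simp only: mult.assoc)
qed

end

section \<open>The degree argument for fourfold sums without opposite terms\<close>

text \<open>In a field, \<open>pair_prod\<close> is nonzero exactly when no two of the four terms are opposite.\<close>

definition noncancelling_sums :: "'a::field set \<Rightarrow> 'a set" where
  "noncancelling_sums X = {x1 + x2 + x3 + x4 | x1 x2 x3 x4.
     x1 \<in> X \<and> x2 \<in> X \<and> x3 \<in> X \<and> x4 \<in> X \<and> pair_prod x1 x2 x3 x4 \<noteq> 0}"

lemma finite_noncancelling_sums: "finite X \<Longrightarrow> finite (noncancelling_sums X)"
proof -
  assume "finite X"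
  then have "finite ((\<lambda>(x1, x2, x3, x4). x1 + x2 + x3 + x4) ` (X \<times> X \<times> X \<times> X))" by simp
  moreover have "noncancelling_sums X \<subseteq> (\<lambda>(x1, x2, x3, x4). x1 + x2 + x3 + x4) ` (X \<times> X \<times> X \<times> X)"
    by (force simp: noncancelling_sums_def image_iff)
  ultimately show ?thesis by (rule finite_subset[rotated])
qed

lemma noncancelling_sums_uminus:
  assumes "uminus ` X = X" "s \<in> noncancelling_sums X"
  shows "- s \<in> noncancelling_sums X"
proof -
  obtain x1 x2 x3 x4 where x: "x1 \<in> X" "x2 \<in> X" "x3 \<in> X" "x4 \<in> X"
      "pair_prod x1 x2 x3 x4 \<noteq> 0" "s = x1 + x2 + x3 + x4"
    using assms(2) by (auto simp: noncancelling_sums_def)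
  have "pair_prod (- x1) (- x2) (- x3) (- x4) = pair_prod x1 x2 x3 x4"
    by (simp add: pair_prod_def algebra_simps)
  moreover have "- x1 \<in> X" "- x2 \<in> X" "- x3 \<in> X" "- x4 \<in> X" using x assms(1) by auto
  moreover have "- s = (- x1) + (- x2) + (- x3) + (- x4)" using x by simp
  ultimately show ?thesis unfolding noncancelling_sums_def using x(5) by (metis (mono_tags, lifting) mem_Collect_eq)
qed

lemma monic_annihilator:
  fixes C :: "'a::field set"
  assumes "finite C" "card C \<le> L"
  obtains q where "q 0 = 1" "\<And>s. s \<in> C \<Longrightarrow> (\<Sum>i\<le>L. q i * s ^ (L - i)) = 0"
proof -
  define p where "p = monom 1 (L - card C) * (\<Prod>c\<in>C. [:- c, 1:])"
  have lead: "lead_coeff p = 1"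
    unfolding p_def lead_coeff_mult lead_coeff_prod by (simp add: degree_monom_eq)
  have "degree p = L"
  proof -
    have "degree p = degree (monom (1::'a) (L - card C)) + degree (\<Prod>c\<in>C. [:- c, 1:])"
      unfolding p_def by (rule degree_mult_eq) (use assms(1) in auto)
    also have "degree (monom (1::'a) (L - card C)) = L - card C" by (rule degree_monom_eq) simp
    also have "degree (\<Prod>c\<in>C. [:- c, 1:]) = card C"
      by (subst degree_prod_eq_sum_degree) auto
    finally show ?thesis using assms(2) by linarith
  qed
  have "(\<Sum>i\<le>L. coeff p (L - i) * s ^ (L - i)) = poly p s" for s
    using sum.nat_diff_reindex[of "\<lambda>i. coeff p i * s ^ i" "Suc L"] \<open>degree p = L\<close>
    by (simp add: poly_altdef lessThan_Suc_atMost)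
  moreover have "poly p s = 0" if "s \<in> C" for s
    using that assms(1) by (auto simp: p_def poly_prod)
  ultimately show ?thesis
    using that[of "\<lambda>i. coeff p (L - i)"] lead \<open>degree p = L\<close> by simp
qed

text \<open>The even part of an annihilating polynomial of even degree is still monic, and it still annihilates a
  symmetric set.\<close>

lemma even_monic_annihilator:
  fixes C :: "'a::field set"
  assumes "finite C" "card C \<le> L" "even L" "\<And>s. s \<in> C \<Longrightarrow> - s \<in> C" "(2::'a) \<noteq> 0"
  obtains q where "q 0 = 1" "\<And>i. odd i \<Longrightarrow> q i = 0"
    "\<And>s. s \<in> C \<Longrightarrow> (\<Sum>i\<le>L. q i * s ^ (L - i)) = 0"
proof -
  obtain r where r: "r 0 = 1" "\<And>s. s \<in> C \<Longrightarrow> (\<Sum>i\<le>L. r i * s ^ (L - i)) = 0"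
    using monic_annihilator[OF assms(1,2)] by blast
  define q where "q i = (if even i then r i else 0)" for i
  have "(\<Sum>i\<le>L. q i * s ^ (L - i)) = 0" if "s \<in> C" for s
  proof -
    have "2 * (\<Sum>i\<le>L. q i * s ^ (L - i)) =
        (\<Sum>i\<le>L. r i * s ^ (L - i)) + (\<Sum>i\<le>L. r i * (- s) ^ (L - i))"
      unfolding sum.distrib[symmetric] sum_distrib_left
    proof (rule sum.cong)
      fix i assume "i \<in> {..L}"
      then show "2 * (q i * s ^ (L - i)) = r i * s ^ (L - i) + r i * (- s) ^ (L - i)"
        using \<open>even L\<close> by (cases "even i") (simp_all add: q_def)
    qed simp
    then show ?thesis using r(2)[OF that] r(2)[OF assms(4)[OF that]] \<open>2 \<noteq> 0\<close> by simp
  qed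
  then show ?thesis using that[of q] r(1) by (simp add: q_def)
qed

context nodes
begin

definition \<Psi> :: "nat \<Rightarrow> nat \<Rightarrow> 'a" where
  "\<Psi> K a = \<Phi> (\<lambda>x1 x2 x3 x4. pair_prod x1 x2 x3 x4 * x1 ^ a * (x1 + x2 + x3 + x4) ^ K)"

lemma \<Phi>_sum_list:
  "\<Phi> (\<lambda>x1 x2 x3 x4. \<Sum>t\<leftarrow>ts. F t x1 x2 x3 x4) = (\<Sum>t\<leftarrow>ts. \<Phi> (F t))"
  by (induction ts) (simp_all add: \<Phi>_zero \<Phi>_add)

lemma \<Psi>_expand:
  "\<Psi> K a = (\<Sum>(k, i, j, l, q)\<leftarrow>pair_mons. of_nat k * \<mu> K (a + i) j l q)"
proof -
  have "\<Psi> K a = \<Phi> (\<lambda>x1 x2 x3 x4. \<Sum>t\<leftarrow>pair_mons. case t of (k, i, j, l, q) \<Rightarrow>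
      of_nat k * (x1 ^ (a + i) * x2 ^ j * x3 ^ l * x4 ^ q * (x1 + x2 + x3 + x4) ^ K))"
    unfolding \<Psi>_def pair_prod_expand sum_list_mult_const[symmetric]
    by (intro \<Phi>_cong arg_cong[where f = sum_list] map_cong refl)
       (auto simp: power_add mult_ac)
  also have "\<dots> = (\<Sum>t\<leftarrow>pair_mons. \<Phi> (\<lambda>x1 x2 x3 x4. case t of (k, i, j, l, q) \<Rightarrow>
      of_nat k * (x1 ^ (a + i) * x2 ^ j * x3 ^ l * x4 ^ q * (x1 + x2 + x3 + x4) ^ K)))"
    by (rule \<Phi>_sum_list)
  also have "\<dots> = (\<Sum>(k, i, j, l, q)\<leftarrow>pair_mons. of_nat k * \<mu> K (a + i) j l q)"
    by (rule arg_cong[where f = sum_list]) (auto simp: \<mu>_def \<Phi>_cmult)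
  finally show ?thesis .
qed

lemma \<Psi>_low: "K + a + 6 < 4 * c \<Longrightarrow> \<Psi> K a = 0"
  unfolding \<Psi>_expand
  by (rule sum_list_0[THEN trans[rotated]], rule arg_cong[where f = sum_list], rule map_cong)
     (auto dest!: pair_mons_degree intro!: \<mu>_low)

lemma pair_mons_inv_facts:
  assumes "char_above TYPE('a) N" "z1 \<le> int N" "z2 \<le> int N" "z3 \<le> int N" "z4 \<le> int N"
  shows "(\<Sum>(k, i, j, l, q)\<leftarrow>pair_mons. of_nat k *
           inv_facts (z1 - int i) (z2 - int j) (z3 - int l) (z4 - int q)) =
         top_coeff (of_int z1) (of_int z2) (of_int z3) (of_int z4) * inv_facts z1 z2 z3 z4"
  unfolding top_coeff_def sum_list_mult_const[symmetric] inv_facts_def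
  by (rule arg_cong[where f = sum_list])
     (auto simp: inv_fact_diff[OF assms(1,2)] inv_fact_diff[OF assms(1,3)]
        inv_fact_diff[OF assms(1,4)] inv_fact_diff[OF assms(1,5)])

lemma \<Psi>_at:
  assumes "char_above TYPE('a) c" "K + a + 6 = 4 * c"
  shows "\<Psi> K a = of_nat (fact K) * (inv_fact (int c - int a) * inv_fact (int c) ^ 3 *
           top_coeff (of_nat c - of_nat a) (of_nat c) (of_nat c) (of_nat c))"
proof -
  have "\<Psi> K a = (\<Sum>t\<leftarrow>pair_mons. of_nat (fact K) * (case t of (k, i, j, l, q) \<Rightarrow> of_nat k *
      inv_facts (int c - int a - int i) (int c - int j) (int c - int l) (int c - int q)))"
    unfolding \<Psi>_expand
  proof (rule arg_cong[where f = sum_list], rule map_cong[OF refl])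
    fix t assume t: "t \<in> set pair_mons"
    obtain k i j l q where e: "t = (k, i, j, l, q)" by (cases t)
    have "i + j + l + q = 6" using pair_mons_degree t e by blast
    then have "K + (a + i) + j + l + q = 4 * c" using assms(2) by simp
    from \<mu>_at[OF assms(1) this] show "(case t of (k, i, j, l, q) \<Rightarrow> of_nat k * \<mu> K (a + i) j l q) =
      of_nat (fact K) * (case t of (k, i, j, l, q) \<Rightarrow> of_nat k *
      inv_facts (int c - int a - int i) (int c - int j) (int c - int l) (int c - int q))"
      by (simp add: e diff_diff_eq del: of_nat_fact)
  qed
  also have "\<dots> = of_nat (fact K) * (\<Sum>(k, i, j, l, q)\<leftarrow>pair_mons. of_nat k *
      inv_facts (int c - int a - int i) (int c - int j) (int c - int l) (int c - int q))"
    by (rule sum_list_const_mult)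
  also have "\<dots> = of_nat (fact K) * (inv_fact (int c - int a) * inv_fact (int c) ^ 3 *
           top_coeff (of_nat c - of_nat a) (of_nat c) (of_nat c) (of_nat c))"
    by (subst pair_mons_inv_facts[OF assms(1)]) (simp_all add: inv_facts_def power3_eq_cube mult_ac del: of_nat_fact)
  finally show ?thesis .
qed

text \<open>At every quadruple either the pair product or the value of the annihilating polynomial is 0.\<close>

lemma annihilator_\<Psi>:
  assumes "\<And>s. s \<in> noncancelling_sums X \<Longrightarrow> (\<Sum>i\<le>L. q i * s ^ (L - i)) = 0"
  shows "(\<Sum>i\<le>L. q i * \<Psi> (b + (L - i)) a) = 0"
proof -
  have "(\<Sum>i\<le>L. q i * \<Psi> (b + (L - i)) a) =
      \<Phi> (\<lambda>x1 x2 x3 x4. \<Sum>i\<le>L. q i * (pair_prod x1 x2 x3 x4 * x1 ^ a * (x1 + x2 + x3 + x4) ^ (b + (L - i))))"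
    by (simp add: \<Phi>_sum \<Phi>_cmult \<Psi>_def)
  also have "\<dots> = \<Phi> (\<lambda>x1 x2 x3 x4. 0)"
  proof (rule \<Phi>_cong)
    fix x1 x2 x3 x4 assume x: "x1 \<in> X" "x2 \<in> X" "x3 \<in> X" "x4 \<in> X"
    let ?s = "x1 + x2 + x3 + x4" and ?V = "pair_prod x1 x2 x3 x4"
    have "?V = 0 \<or> (\<Sum>i\<le>L. q i * ?s ^ (L - i)) = 0"
      using assms[of ?s] x by (auto simp: noncancelling_sums_def)
    moreover have "(\<Sum>i\<le>L. q i * (?V * x1 ^ a * ?s ^ (b + (L - i)))) =
       ?V * x1 ^ a * ?s ^ b * (\<Sum>i\<le>L. q i * ?s ^ (L - i))"
      by (simp only: sum_distrib_left power_add mult_ac)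
    ultimately show "(\<Sum>i\<le>L. q i * (?V * x1 ^ a * ?s ^ (b + (L - i)))) = 0" by auto
  qed
  finally show ?thesis by (simp add: \<Phi>_zero)
qed

text \<open>With at most \<open>L = 4 c - 6\<close> sums, all terms of the annihilator relation except the leading one have degree
  below \<open>4 c\<close>; so \<open>\<Psi> L 0\<close> would be 0, whereas \<open>\<Psi>_at\<close> and \<open>top_coeff_diag\<close> show that it is not.\<close>

theorem card_noncancelling_sums_generic:
  assumes "2 \<le> c" "char_above TYPE('a) (4 * c - 6)" "8 * (of_nat c - 1)\<^sup>2 \<noteq> (1::'a)"
  shows "4 * c - 5 \<le> card (noncancelling_sums X)"
proof (rule ccontr)
  define L where "L = 4 * c - 6"
  assume "\<not> ?thesis"
  then have "card (noncancelling_sums X) \<le> L" using assms(1) by (simp add: L_def)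
  then obtain q where q: "q 0 = 1" "\<And>s. s \<in> noncancelling_sums X \<Longrightarrow> (\<Sum>i\<le>L. q i * s ^ (L - i)) = 0"
    using monic_annihilator[OF finite_noncancelling_sums[OF fin]] by blast
  have "(\<Sum>i\<le>L. q i * \<Psi> (0 + (L - i)) 0) = \<Psi> L 0"
  proof (subst sum.remove[of _ 0])
    have "(\<Sum>i\<in>{..L} - {0}. q i * \<Psi> (0 + (L - i)) 0) = 0"
      by (rule sum.neutral) (use assms(1) in \<open>auto intro!: \<Psi>_low simp: L_def\<close>)
    then show "q 0 * \<Psi> (0 + (L - 0)) 0 + (\<Sum>i\<in>{..L} - {0}. q i * \<Psi> (0 + (L - i)) 0) = \<Psi> L 0"
      using q(1) by simp
  qed auto
  then have zero: "\<Psi> L 0 = 0" using annihilator_\<Psi>[where q = q and L = L and b = 0 and a = 0] q(2) by simp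
  have ca: "char_above TYPE('a) c" by (rule char_above_mono[OF assms(2)]) (use assms(1) in simp)
  have "of_nat (fact L) \<noteq> (0::'a)"
    using of_nat_fact_nonzero[OF assms(2), of L] by (simp add: L_def del: of_nat_fact)
  moreover have "inv_fact (int c) \<noteq> (0::'a)" by (rule inv_fact_nonzero[OF ca]) simp_all
  moreover have "of_nat c \<noteq> (0::'a)" "of_nat (c - 1) \<noteq> (0::'a)" "of_nat 2 \<noteq> (0::'a)"
    by (rule char_aboveD[OF assms(2)]; use assms(1) in simp)+
  moreover from this(3) have "(8::'a) \<noteq> 0"
    using power_not_zero[of "2::'a" 3] by simp
  ultimately have "\<Psi> L 0 \<noteq> 0"
    using assms(1,3) \<Psi>_at[OF ca, of L 0]
    by (simp add: L_def top_coeff_diag of_nat_diff del: of_nat_fact)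
  with zero show False by simp
qed

end

context gapped_nodes
begin

lemma \<Psi>_gap_zero:
  assumes "4 * c < K + a + 6" "K + a + 6 < 4 * c + g"
  shows "\<Psi> K a = 0"
  unfolding \<Psi>_expand
  by (rule sum_list_0[THEN trans[rotated]], rule arg_cong[where f = sum_list], rule map_cong)
     (use assms in \<open>auto dest!: pair_mons_degree intro!: \<mu>_gap_zero\<close>)

text \<open>The first summand comes from the monomial with the additional \<open>x\<^sub>1\<^sup>g\<close>; the other three monomials
  contribute equally, since \<open>top_coeff\<close> is symmetric.\<close>

lemma \<Psi>_gap:
  assumes "char_above TYPE('a) (c + g)" "K + a + 6 = 4 * c + g"
  shows "\<Psi> K a = moment (c + g) * of_nat (fact K) * inv_fact (int c) ^ 2 *
    (inv_fact (int c + int g - int a) * inv_fact (int c) *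
       top_coeff (of_nat c + of_nat g - of_nat a) (of_nat c) (of_nat c) (of_nat c) +
     3 * inv_fact (int c - int a) * inv_fact (int c + int g) *
       top_coeff (of_nat c - of_nat a) (of_nat c + of_nat g) (of_nat c) (of_nat c))"
proof -
  let ?m = "moment (c + g) * of_nat (fact K)"
  let ?z = "int c - int a"
  define S where "S z1 z2 z3 z4 = (\<Sum>(k, i, j, l, q)\<leftarrow>pair_mons. of_nat k *
      inv_facts (z1 - int i) (z2 - int j) (z3 - int l) (z4 - int q))" for z1 z2 z3 z4
  have S: "S z1 z2 z3 z4 = top_coeff (of_int z1) (of_int z2) (of_int z3) (of_int z4) * inv_facts z1 z2 z3 z4"
    if "z1 \<le> int (c + g)" "z2 \<le> int (c + g)" "z3 \<le> int (c + g)" "z4 \<le> int (c + g)" for z1 z2 z3 z4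
    unfolding S_def by (rule pair_mons_inv_facts[OF assms(1) that])
  have "\<Psi> K a = (\<Sum>t\<leftarrow>pair_mons. ?m * (case t of (k, i, j, l, q) \<Rightarrow> of_nat k *
      gap_facts (?z - int i) (int c - int j) (int c - int l) (int c - int q)))"
    unfolding \<Psi>_expand
  proof (rule arg_cong[where f = sum_list], rule map_cong[OF refl])
    fix t assume t: "t \<in> set pair_mons"
    obtain k i j l q where e: "t = (k, i, j, l, q)" by (cases t)
    have "i + j + l + q = 6" using pair_mons_degree t e by blast
    then have "K + (a + i) + j + l + q = 4 * c + g" using assms(2) by simp
    from \<mu>_gap[OF assms(1) this] show "(case t of (k, i, j, l, q) \<Rightarrow> of_nat k * \<mu> K (a + i) j l q) =
      ?m * (case t of (k, i, j, l, q) \<Rightarrow> of_nat k *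
      gap_facts (?z - int i) (int c - int j) (int c - int l) (int c - int q))"
      by (simp add: e diff_diff_eq del: of_nat_fact)
  qed
  also have "\<dots> = ?m * (\<Sum>(k, i, j, l, q)\<leftarrow>pair_mons. of_nat k *
      gap_facts (?z - int i) (int c - int j) (int c - int l) (int c - int q))"
    by (rule sum_list_const_mult)
  also have "(\<Sum>(k, i, j, l, q)\<leftarrow>pair_mons. of_nat k *
      gap_facts (?z - int i) (int c - int j) (int c - int l) (int c - int q)) =
      S (?z + int g) (int c) (int c) (int c) + S ?z (int c + int g) (int c) (int c) +
      S ?z (int c) (int c + int g) (int c) + S ?z (int c) (int c) (int c + int g)"
    unfolding S_def gap_facts_def sum_list_addf[symmetric]
    by (rule arg_cong[where f = sum_list]) (auto simp: algebra_simps)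
  also have "\<dots> = inv_fact (int c) ^ 2 * (inv_fact (int c + int g - int a) * inv_fact (int c) *
       top_coeff (of_nat c + of_nat g - of_nat a) (of_nat c) (of_nat c) (of_nat c) +
     3 * inv_fact (int c - int a) * inv_fact (int c + int g) *
       top_coeff (of_nat c - of_nat a) (of_nat c + of_nat g) (of_nat c) (of_nat c))"
  proof -
    have 1: "top_coeff x u v u = top_coeff x v u u" "top_coeff x u u v = top_coeff x v u u" for x u v :: 'a
      using top_coeff_swap(1)[of x v u u] top_coeff_swap(2)[of x v u u] by simp_all
    show ?thesis
      by (simp add: S 1[of _ "of_nat c" "of_nat c + of_nat g"] inv_facts_def power2_eq_square algebra_simps)
  qed
  finally show ?thesis by (simp only: mult.assoc)
qed

end

section \<open>Values of the leading coefficient when \<open>8 (c - 1)\<^sup>2 = 1\<close>\<close>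

text \<open>With \<open>c = y + 1\<close>, the relation \<open>8 y\<^sup>2 = 1\<close> makes \<open>top_coeff\<close> vanish at \<open>(c, c, c, c)\<close>; this is
  the root \<open>z = 0\<close>. The root \<open>z = - 1\<close> comes with it: multiplying by the sum of the variables distributes
  this coefficient evenly over four positions. The proof exhibits the multiple of \<open>8 y\<^sup>2 - 1\<close> by which the
  two sides differ as polynomials in \<open>y\<close> and \<open>z\<close>.\<close>

lemma top_coeff_axis:
  assumes "8 * (y * y) = (1::'a::field)"
  shows "top_coeff (y + 1 + z) (y + 1) (y + 1) (y + 1) =
    2 * (y + 1) * (y + 1) * z * (z + 1) * ((4 * y + 1) * z + 2 * (y + 1))"
proof -
  have "top_coeff (y + 1 + z) (y + 1) (y + 1) (y + 1) =
    2 * (y + 1) * (y + 1) * z * (z + 1) * ((4 * y + 1) * z + 2 * (y + 1)) +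
    (8 * (y * y) - 1) * (8 * (y * y * y * y) + 12 * (y * y * y * z) + 24 * (y * y * y) + 6 * (y * y * z * z)
      + 30 * (y * y * z) + 24 * (y * y) + 12 * (y * z * z) + 24 * (y * z) + 8 * y + 6 * (z * z) + 6 * z)"
    unfolding top_coeff_def pair_mons_def by (simp add: algebra_simps)
  with assms show ?thesis by simp
qed

text \<open>Used to reduce polynomials in \<open>y\<close> to linear ones; the instances give the quotient \<open>q\<close> by
  \<open>8 y\<^sup>2 - 1\<close> explicitly.\<close>

lemma residue_mod_relation:
  assumes "8 * (y * y) = (1::'a::comm_ring_1)" "e = r + (8 * (y * y) - 1) * q"
  shows "e = r"
  using assms by simp

text \<open>The values at \<open>(c - a, c + G, c, c)\<close> for \<open>a = 2, 3, 4\<close>, where \<open>c = y + 1\<close> and \<open>G = 1 - 6 y\<close>.\<close>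

lemma top_coeff_values_resonance:
  fixes y :: "'a::field"
  assumes y: "8 * (y * y) = 1"
  shows "4 * top_coeff (y - 1) (2 - 5 * y) (y + 1) (y + 1) = 352 * y - 145"
    and "8 * top_coeff (y - 2) (2 - 5 * y) (y + 1) (y + 1) = 2784 * y - 1227"
    and "2 * top_coeff (y - 3) (2 - 5 * y) (y + 1) (y + 1) = 1792 * y - 805"
proof -
  show "4 * top_coeff (y - 1) (2 - 5 * y) (y + 1) (y + 1) = 352 * y - 145"
    by (rule residue_mod_relation[OF y, where q =
      "- 256 * (y * y * y * y) - 48 * (y * y * y) + 184 * (y * y) - 112 * y - 17"])
      (simp add: top_coeff_def pair_mons_def algebra_simps)
  show "8 * top_coeff (y - 2) (2 - 5 * y) (y + 1) (y + 1) = 2784 * y - 1227"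
    by (rule residue_mod_relation[OF y, where q =
      "- 512 * (y * y * y * y) + 288 * (y * y * y) + 648 * (y * y) - 800 * y - 75"])
      (simp add: top_coeff_def pair_mons_def algebra_simps)
  show "2 * top_coeff (y - 3) (2 - 5 * y) (y + 1) (y + 1) = 1792 * y - 805"
    by (rule residue_mod_relation[OF y, where q =
      "- 128 * (y * y * y * y) + 168 * (y * y * y) + 232 * (y * y) - 472 * y - 37"])
      (simp add: top_coeff_def pair_mons_def algebra_simps)
qed

text \<open>The values at \<open>(c - a, c + G, c, c)\<close> for \<open>a = 2, 3\<close>, where \<open>c = y + 1\<close> and \<open>G = 3 - 4 y\<close>.\<close>

lemma top_coeff_values_boundary:
  fixes y :: "'a::field"
  assumes y: "8 * (y * y) = 1"
  shows "4 * top_coeff (y - 1) (4 - 3 * y) (y + 1) (y + 1) = 28 * y - 119"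
    and "4 * top_coeff (y - 2) (4 - 3 * y) (y + 1) (y + 1) = 364 * y - 959"
proof -
  show "4 * top_coeff (y - 1) (4 - 3 * y) (y + 1) (y + 1) = 28 * y - 119"
    by (rule residue_mod_relation[OF y, where q =
      "- 32 * (y * y * y * y) + 80 * (y * y * y) - 24 * (y * y) - 84 * y + 73"])
      (simp add: top_coeff_def pair_mons_def algebra_simps)
  show "4 * top_coeff (y - 2) (4 - 3 * y) (y + 1) (y + 1) = 364 * y - 959"
    by (rule residue_mod_relation[OF y, where q =
      "- 32 * (y * y * y * y) + 96 * (y * y * y) - 40 * (y * y) - 164 * y + 193"])
      (simp add: top_coeff_def pair_mons_def algebra_simps)
qed

lemma falling_4 [simp]: "falling z 4 = z * (z - 1) * (z - 2) * (z - 3)"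
  by (simp add: falling_def eval_nat_numeral)

definition axis_coeff :: "'a::field \<Rightarrow> 'a \<Rightarrow> 'a" where
  "axis_coeff y z = 2 * (y + 1) * (y + 1) * z * (z + 1) * ((4 * y + 1) * z + 2 * (y + 1))"

text \<open>\<open>gap_term\<close> and \<open>base_term\<close> are the factors of \<open>H\<^bsub>c + g\<^esub>\<close> and of \<open>E\<close> in the relation with index \<open>a\<close>,
  after removal of the factorials.\<close>

definition gap_term :: "'a::field \<Rightarrow> 'a \<Rightarrow> nat \<Rightarrow> 'a" where
  "gap_term y G a = falling (y + 1 + G) a * axis_coeff y (G - of_nat a) +
     3 * falling (y + 1) a * top_coeff (y + 1 - of_nat a) (y + 1 + G) (y + 1) (y + 1)"

definition base_term :: "'a::field \<Rightarrow> nat \<Rightarrow> 'a" where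
  "base_term y a = falling (y + 1) a * axis_coeff y (- of_nat a)"

lemma base_term_values:
  fixes y :: "'a::field"
  assumes y: "8 * (y * y) = 1"
  shows "8 * base_term y 2 = - 75 * y - 33"
    and "64 * base_term y 3 = 2436 * y + 1113"
    and "32 * base_term y 4 = - 6069 * y - 2835"
proof -
  have "1 * axis_coeff y (- 2) = - 27 * y - 6"
    by (rule residue_mod_relation[OF y, where q = "- 3 * y - 6"])
      (simp add: axis_coeff_def algebra_simps)
  moreover have "8 * base_term y 2 = 8 * (falling (y + 1) 2 * (1 * axis_coeff y (- 2)))"
    by (simp add: base_term_def mult_ac del: falling_numerals falling_4)
  ultimately have "8 * base_term y 2 = 8 * (falling (y + 1) 2 * (- 27 * y - 6))"
    by simp
  also have "\<dots> = - 75 * y - 33"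
    by (rule residue_mod_relation[OF y, where q = "- 27 * y - 33"])
      (simp add: algebra_simps)
  finally show "8 * base_term y 2 = - 75 * y - 33" .
  have "2 * axis_coeff y (- 3) = - 318 * y - 87"
    by (rule residue_mod_relation[OF y, where q = "- 30 * y - 63"])
      (simp add: axis_coeff_def algebra_simps)
  moreover have "64 * base_term y 3 = 32 * (falling (y + 1) 3 * (2 * axis_coeff y (- 3)))"
    by (simp add: base_term_def mult_ac del: falling_numerals falling_4)
  ultimately have "64 * base_term y 3 = 32 * (falling (y + 1) 3 * (- 318 * y - 87))"
    by simp
  also have "\<dots> = 2436 * y + 1113"
    by (rule residue_mod_relation[OF y, where q = "- 1272 * (y * y) - 348 * y + 1113"])
      (simp add: algebra_simps)
  finally show "64 * base_term y 3 = 2436 * y + 1113" .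
  have "1 * axis_coeff y (- 4) = - 474 * y - 138"
    by (rule residue_mod_relation[OF y, where q = "- 42 * y - 90"])
      (simp add: axis_coeff_def algebra_simps)
  moreover have "32 * base_term y 4 = 32 * (falling (y + 1) 4 * (1 * axis_coeff y (- 4)))"
    by (simp add: base_term_def mult_ac del: falling_numerals falling_4)
  ultimately have "32 * base_term y 4 = 32 * (falling (y + 1) 4 * (- 474 * y - 138))"
    by simp
  also have "\<dots> = - 6069 * y - 2835"
    by (rule residue_mod_relation[OF y, where q = "- 1896 * (y * y * y) + 3240 * (y * y) + 2763 * y - 2835"])
      (simp add: algebra_simps)
  finally show "32 * base_term y 4 = - 6069 * y - 2835" .
qed

lemma gap_term_values_resonance:
  fixes y :: "'a::field"
  assumes y: "8 * (y * y) = 1"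
  shows "16 * gap_term y (1 - 6 * y) 2 = - 1128 * y + 615"
    and "16 * gap_term y (1 - 6 * y) 3 = 3948 * y - 2667"
    and "64 * gap_term y (1 - 6 * y) 4 = - 94896 * y + 66867"
proof -
  have w: "4 * axis_coeff y (1 - 6 * y - 2) = - 672 * y - 231"
    by (rule residue_mod_relation[OF y, where q = "- 864 * (y * y * y * y) - 2160 * (y * y * y) - 1848 * (y * y) - 720 * y - 231"])
      (simp add: axis_coeff_def algebra_simps)
  have e: "y + 1 - 2 = y - 1" "y + 1 + (1 - 6 * y) = 2 - 5 * y" by simp_all
  have "16 * gap_term y (1 - 6 * y) 2 = 4 * (falling (y + 1 + (1 - 6 * y)) 2 * (4 * axis_coeff y (1 - 6 * y - 2)) +
      3 * falling (y + 1) 2 * (4 * top_coeff (y + 1 - 2) (y + 1 + (1 - 6 * y)) (y + 1) (y + 1)))"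
    by (simp add: gap_term_def distrib_left mult_ac del: falling_numerals)
  also have "\<dots> = 4 * (falling (y + 1 + (1 - 6 * y)) 2 * (- 672 * y - 231) + 3 * falling (y + 1) 2 * (352 * y - 145))"
    unfolding w unfolding e top_coeff_values_resonance(1)[OF y] ..
  also have "\<dots> = - 1128 * y + 615"
    by (rule residue_mod_relation[OF y, where q = "- 7872 * y + 2463"])
      (simp add: algebra_simps)
  finally show "16 * gap_term y (1 - 6 * y) 2 = - 1128 * y + 615" .
  have w: "8 * axis_coeff y (1 - 6 * y - 3) = - 3864 * y - 1365"
    by (rule residue_mod_relation[OF y, where q = "- 1728 * (y * y * y * y) - 5184 * (y * y * y) - 5928 * (y * y) - 3480 * y - 1365"])
      (simp add: axis_coeff_def algebra_simps)
  have e: "y + 1 - 3 = y - 2" "y + 1 + (1 - 6 * y) = 2 - 5 * y" by simp_all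
  have "16 * gap_term y (1 - 6 * y) 3 = 2 * (falling (y + 1 + (1 - 6 * y)) 3 * (8 * axis_coeff y (1 - 6 * y - 3)) +
      3 * falling (y + 1) 3 * (8 * top_coeff (y + 1 - 3) (y + 1 + (1 - 6 * y)) (y + 1) (y + 1)))"
    by (simp add: gap_term_def distrib_left mult_ac del: falling_numerals)
  also have "\<dots> = 2 * (falling (y + 1 + (1 - 6 * y)) 3 * (- 3864 * y - 1365) + 3 * falling (y + 1) 3 * (2784 * y - 1227))"
    unfolding w unfolding e top_coeff_values_resonance(2)[OF y] ..
  also have "\<dots> = 3948 * y - 2667"
    by (rule residue_mod_relation[OF y, where q = "122838 * (y * y) - 30714 * y - 2667"])
      (simp add: algebra_simps)
  finally show "16 * gap_term y (1 - 6 * y) 3 = 3948 * y - 2667" .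
  have w: "2 * axis_coeff y (1 - 6 * y - 4) = - 2112 * y - 747"
    by (rule residue_mod_relation[OF y, where q = "- 432 * (y * y * y * y) - 1512 * (y * y * y) - 2112 * (y * y) - 1560 * y - 723"])
      (simp add: axis_coeff_def algebra_simps)
  have e: "y + 1 - 4 = y - 3" "y + 1 + (1 - 6 * y) = 2 - 5 * y" by simp_all
  have "64 * gap_term y (1 - 6 * y) 4 = 32 * (falling (y + 1 + (1 - 6 * y)) 4 * (2 * axis_coeff y (1 - 6 * y - 4)) +
      3 * falling (y + 1) 4 * (2 * top_coeff (y + 1 - 4) (y + 1 + (1 - 6 * y)) (y + 1) (y + 1)))"
    by (simp add: gap_term_def distrib_left mult_ac del: falling_numerals)
  also have "\<dots> = 32 * (falling (y + 1 + (1 - 6 * y)) 4 * (- 2112 * y - 747) + 3 * falling (y + 1) 4 * (1792 * y - 805))"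
    unfolding w unfolding e top_coeff_values_resonance(3)[OF y] ..
  also have "\<dots> = - 94896 * y + 66867"
    by (rule residue_mod_relation[OF y, where q = "- 5258496 * (y * y * y) + 191832 * (y * y) + 298704 * y + 66867"])
      (simp add: algebra_simps)
  finally show "64 * gap_term y (1 - 6 * y) 4 = - 94896 * y + 66867" .
qed

lemma gap_term_values_boundary:
  fixes y :: "'a::field"
  assumes y: "8 * (y * y) = 1"
  shows "8 * gap_term y (3 - 4 * y) 2 = - 1260 * y + 63"
    and "32 * gap_term y (3 - 4 * y) 3 = 14028 * y + 945"
proof -
  have w: "4 * axis_coeff y (3 - 4 * y - 2) = - 20 * y + 1"
    by (rule residue_mod_relation[OF y, where q = "- 256 * (y * y * y * y) - 288 * (y * y * y) + 152 * (y * y) + 140 * y - 47"])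
      (simp add: axis_coeff_def algebra_simps)
  have e: "y + 1 - 2 = y - 1" "y + 1 + (3 - 4 * y) = 4 - 3 * y" by simp_all
  have "8 * gap_term y (3 - 4 * y) 2 = 2 * (falling (y + 1 + (3 - 4 * y)) 2 * (4 * axis_coeff y (3 - 4 * y - 2)) +
      3 * falling (y + 1) 2 * (4 * top_coeff (y + 1 - 2) (y + 1 + (3 - 4 * y)) (y + 1) (y + 1)))"
    by (simp add: gap_term_def distrib_left mult_ac del: falling_numerals)
  also have "\<dots> = 2 * (falling (y + 1 + (3 - 4 * y)) 2 * (- 20 * y + 1) + 3 * falling (y + 1) 2 * (28 * y - 119))"
    unfolding w unfolding e top_coeff_values_boundary(1)[OF y] ..
  also have "\<dots> = - 1260 * y + 63"
    by (rule residue_mod_relation[OF y, where q = "- 24 * y + 39"])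
      (simp add: algebra_simps)
  finally show "8 * gap_term y (3 - 4 * y) 2 = - 1260 * y + 63" .
  have w: "4 * axis_coeff y (3 - 4 * y - 3) = - 20 * y + 1"
    by (rule residue_mod_relation[OF y, where q = "- 256 * (y * y * y * y) - 480 * (y * y * y) - 184 * (y * y) + 44 * y + 1"])
      (simp add: axis_coeff_def algebra_simps)
  have e: "y + 1 - 3 = y - 2" "y + 1 + (3 - 4 * y) = 4 - 3 * y" by simp_all
  have "32 * gap_term y (3 - 4 * y) 3 = 8 * (falling (y + 1 + (3 - 4 * y)) 3 * (4 * axis_coeff y (3 - 4 * y - 3)) +
      3 * falling (y + 1) 3 * (4 * top_coeff (y + 1 - 3) (y + 1 + (3 - 4 * y)) (y + 1) (y + 1)))"
    by (simp add: gap_term_def distrib_left mult_ac del: falling_numerals)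
  also have "\<dots> = 8 * (falling (y + 1 + (3 - 4 * y)) 3 * (- 20 * y + 1) + 3 * falling (y + 1) 3 * (364 * y - 959))"
    unfolding w unfolding e top_coeff_values_boundary(2)[OF y] ..
  also have "\<dots> = 14028 * y + 945"
    by (rule residue_mod_relation[OF y, where q = "1632 * (y * y) - 4524 * y + 753"])
      (simp add: algebra_simps)
  finally show "32 * gap_term y (3 - 4 * y) 3 = 14028 * y + 945" .
qed

lemma scaled_products:
  fixes u :: "'a::comm_ring_1"
  assumes "u * r * t = v * r' * t'" "a * b = d * e * f"
  shows "u * (a * r) * (b * t) = d * v * (e * r') * (f * t')"
proof -
  have "u * (a * r) * (b * t) = (a * b) * (u * r * t)" by (simp add: mult_ac)
  also have "\<dots> = (d * e * f) * (v * r' * t')" by (simp only: assms)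
  finally show ?thesis by (simp add: mult_ac)
qed

text \<open>The hypothesis \<open>E\<close> reduces to a linear equation for \<open>y\<close>. By \<open>8 y\<^sup>2 = 1\<close>, the integer
  \<open>2\<^sup>2 \<cdot> 7\<^sup>5\<close> is then 0 in the field.\<close>

lemma boundary_elimination:
  fixes y :: "'a::field"
  assumes y: "8 * (y * y) = 1" and nz: "(2::'a) \<noteq> 0" "(3::'a) \<noteq> 0" "(5::'a) \<noteq> 0" "(7::'a) \<noteq> 0"
    and E: "(4 * y - 2 + (3 - 4 * y) - 2) * gap_term y (3 - 4 * y) 2 * base_term y 3 =
            (4 * y - 2 - 2) * gap_term y (3 - 4 * y) 3 * base_term y 2"
  shows False
proof -
  have "(4 * y - 2 + (3 - 4 * y) - 2) * (8 * gap_term y (3 - 4 * y) 2) * (64 * base_term y 3) =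
        2 * (4 * y - 2 - 2) * (32 * gap_term y (3 - 4 * y) 3) * (8 * base_term y 2)"
    by (rule scaled_products[OF E]) simp
  then have "(4 * y - 2 + (3 - 4 * y) - 2) * (- 1260 * y + 63) * (2436 * y + 1113) -
        2 * (4 * y - 2 - 2) * (14028 * y + 945) * (- 75 * y - 33) = 0" (is "?D = 0")
    unfolding gap_term_values_boundary[OF y] base_term_values[OF y] by simp
  moreover have "?D = - 1719900 * y - 454230"
    by (rule residue_mod_relation[OF y, where q = "1052100 * y - 134631"]) (simp add: algebra_simps)
  moreover have "2 * 3 * 3 * 5 * 7 * 7 * (390 * y + 103) = - ?D" unfolding calculation(2) by (simp add: algebra_simps)
  ultimately have "2 * 3 * 3 * 5 * 7 * 7 * (390 * y + 103) = 0" by (simp only: minus_zero)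
  then have "390 * y + 103 = 0" using nz by (simp only: mult_eq_0_iff simp_thms)
  then have "390 * y = - (103::'a)" by (simp add: eq_neg_iff_add_eq_0)
  then have "8 * ((390 * y) * (390 * y)) = (8 * (103 * 103) :: 'a)" by simp
  moreover have "8 * ((390 * y) * (390 * y)) = (390 * 390 * (8 * (y * y)))" by simp
  ultimately have "390 * 390 - 8 * (103 * 103) = (0::'a)" unfolding y by (simp only: mult_1_right diff_self)
  moreover have "2 * 2 * 7 * 7 * 7 * 7 * 7 = (390 * 390 - 8 * (103 * 103) :: 'a)" by simp
  ultimately have "2 * 2 * 7 * 7 * 7 * 7 * 7 = (0::'a)" by simp
  with nz show False by (simp only: mult_eq_0_iff simp_thms)
qed

text \<open>Each of \<open>E3\<close> and \<open>E4\<close> reduces to a linear equation for \<open>y\<close>. By \<open>8 y\<^sup>2 = 1\<close>, the integers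
  \<open>7\<^sup>6 \<cdot> 41\<close> and \<open>2\<^sup>2 \<cdot> 7\<^sup>5 \<cdot> 68633\<close> are then 0 in the field. The second equation excludes characteristic 41, which the first
  leaves open.\<close>

lemma resonance_elimination:
  fixes y :: "'a::field"
  assumes y: "8 * (y * y) = 1" and nz: "(2::'a) \<noteq> 0" "(3::'a) \<noteq> 0" "(7::'a) \<noteq> 0"
    and E3: "(4 * y - 2 + (1 - 6 * y) - 2) * gap_term y (1 - 6 * y) 2 * base_term y 3 =
             (4 * y - 2 - 2) * gap_term y (1 - 6 * y) 3 * base_term y 2"
    and E4: "(4 * y - 2 + (1 - 6 * y) - 2) * (4 * y - 2 + (1 - 6 * y) - 3) *
               gap_term y (1 - 6 * y) 2 * base_term y 4 =
             (4 * y - 2 - 2) * (4 * y - 2 - 3) * gap_term y (1 - 6 * y) 4 * base_term y 2"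
  shows False
proof -
  have "(4 * y - 2 + (1 - 6 * y) - 2) * (16 * gap_term y (1 - 6 * y) 2) * (64 * base_term y 3) =
        8 * (4 * y - 2 - 2) * (16 * gap_term y (1 - 6 * y) 3) * (8 * base_term y 2)"
    by (rule scaled_products[OF E3]) simp
  then have "(4 * y - 2 + (1 - 6 * y) - 2) * (- 1128 * y + 615) * (2436 * y + 1113) -
        8 * (4 * y - 2 - 2) * (3948 * y - 2667) * (- 75 * y - 33) = 0" (is "?D3 = 0")
    unfolding gap_term_values_resonance[OF y] base_term_values[OF y] by simp
  moreover have "?D3 = - 810306 * y + 269262"
    by (rule residue_mod_relation[OF y, where q = "1871352 * y - 493605"]) (simp add: algebra_simps)
  moreover have "2 * 3 * 3 * 7 * (6431 * y - 2137) = - ?D3" unfolding calculation(2) by (simp add: algebra_simps)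
  ultimately have "2 * 3 * 3 * 7 * (6431 * y - 2137) = 0" by (simp only: minus_zero)
  then have "6431 * y - 2137 = 0" using nz by (simp only: mult_eq_0_iff simp_thms)
  then have "6431 * y = (2137::'a)" by (simp add: eq_neg_iff_add_eq_0)
  then have "8 * ((6431 * y) * (6431 * y)) = (8 * (2137 * 2137) :: 'a)" by simp
  moreover have "8 * ((6431 * y) * (6431 * y)) = 6431 * 6431 * (8 * (y * y))" by simp
  ultimately have "6431 * 6431 - 8 * (2137 * 2137) = (0::'a)" unfolding y by (simp only: mult_1_right diff_self)
  moreover have "7 * 7 * 7 * 7 * 7 * 7 * 41 = (6431 * 6431 - 8 * (2137 * 2137) :: 'a)" by simp
  ultimately have "7 * 7 * 7 * 7 * 7 * 7 * 41 = (0::'a)" by simp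
  then have p41: "41 = (0::'a)" using nz by (simp only: mult_eq_0_iff simp_thms)
  have "(4 * y - 2 + (1 - 6 * y) - 2) * (4 * y - 2 + (1 - 6 * y) - 3) *
          (16 * gap_term y (1 - 6 * y) 2) * (32 * base_term y 4) =
        1 * ((4 * y - 2 - 2) * (4 * y - 2 - 3)) * (64 * gap_term y (1 - 6 * y) 4) * (8 * base_term y 2)"
    by (rule scaled_products[OF E4]) simp
  then have "4 * ((4 * y - 2 + (1 - 6 * y) - 2) * (4 * y - 2 + (1 - 6 * y) - 3) * (- 1128 * y + 615) * (- 6069 * y - 2835) -
        (4 * y - 2 - 2) * (4 * y - 2 - 3) * (- 94896 * y + 66867) * (- 75 * y - 33)) = 0" (is "?D4 = 0")
    unfolding gap_term_values_resonance[OF y] base_term_values[OF y] by simp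
  moreover have "?D4 = - 100342494 * y + 33858657"
    by (rule residue_mod_relation[OF y, where q = "- 43245936 * (y * y) + 190028970 * y - 58981023"])
       (simp add: algebra_simps)
  moreover have "3 * 3 * 7 * 7 * (227534 * y - 76777) = - ?D4" unfolding calculation(2) by (simp add: algebra_simps)
  ultimately have "3 * 3 * 7 * 7 * (227534 * y - 76777) = 0" by (simp only: minus_zero)
  then have "227534 * y - 76777 = 0" using nz by (simp only: mult_eq_0_iff simp_thms)
  then have "227534 * y = (76777::'a)" by (simp add: eq_neg_iff_add_eq_0)
  then have "8 * ((227534 * y) * (227534 * y)) = (8 * (76777 * 76777) :: 'a)" by simp
  moreover have "8 * ((227534 * y) * (227534 * y)) = 227534 * 227534 * (8 * (y * y))" by simp
  ultimately have "227534 * 227534 - 8 * (76777 * 76777) = (0::'a)" unfolding y by (simp only: mult_1_right diff_self)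
  moreover have "2 * 2 * 7 * 7 * 7 * 7 * 7 * 68633 = (227534 * 227534 - 8 * (76777 * 76777) :: 'a)" by simp
  ultimately have "2 * 2 * 7 * 7 * 7 * 7 * 7 * 68633 = (0::'a)" by simp
  then have "68633 = (0::'a)" using nz by (simp only: mult_eq_0_iff simp_thms)
  moreover have "1 = 41 * 1674 - (68633::'a)" by simp
  ultimately show False using p41 by simp
qed

section \<open>A first-order recurrence between cubic polynomials\<close>

text \<open>The difference of the two sides of the recurrence is a polynomial of degree at most 6, since the terms of
  degree 7 cancel; with seven roots it is 0. If \<open>Q\<close> had degree \<open>d\<close>, comparing the coefficients of
  degree \<open>d + 3\<close> would give \<open>G = 3 - d\<close>.\<close>

lemma shift_recurrence_cubic:
  fixes C G :: "'a::idom" and A :: "'a set"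
  assumes A: "finite A" "7 \<le> card A"
    and W: "\<And>z. W z = w0 + w1 * z + w2 * z ^ 2 + w3 * z ^ 3" "w3 \<noteq> 0"
    and Q: "\<And>z. Q z = r0 + r1 * z + r2 * z ^ 2 + r3 * z ^ 3"
    and rec: "\<And>z. z \<in> A \<Longrightarrow> (C + G - z) * W (z + 1) * Q z = (C - z) * W z * Q (z + 1)"
    and G: "G \<noteq> 0" "G \<noteq> 1" "G \<noteq> 2" "G \<noteq> 3"
  shows "Q z = 0"
proof -
  \<comment> \<open>The coefficients of the difference of the two sides, in ascending order of degree.\<close>
  define S where "S = [:
      C * r0 * w1 + C * r0 * w2 + C * r0 * w3 - C * r1 * w0 - C * r2 * w0 - C * r3 * w0 + G * r0 * w0
        + G * r0 * w1 + G * r0 * w2 + G * r0 * w3,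
      2 * C * r0 * w2 + 3 * C * r0 * w3 + C * r1 * w2 + C * r1 * w3 - 2 * C * r2 * w0 - C * r2 * w1
        - 3 * C * r3 * w0 - C * r3 * w1 + G * r0 * w1 + 2 * G * r0 * w2 + 3 * G * r0 * w3 + G * r1 * w0
        + G * r1 * w1 + G * r1 * w2 + G * r1 * w3 - r0 * w1 - r0 * w2 - r0 * w3 + r1 * w0 + r2 * w0
        + r3 * w0,
      3 * C * r0 * w3 + C * r1 * w2 + 3 * C * r1 * w3 - C * r2 * w1 + C * r2 * w3 - 3 * C * r3 * w0
        - 3 * C * r3 * w1 - C * r3 * w2 + G * r0 * w2 + 3 * G * r0 * w3 + G * r1 * w1 + 2 * G * r1 * w2
        + 3 * G * r1 * w3 + G * r2 * w0 + G * r2 * w1 + G * r2 * w2 + G * r2 * w3 - 2 * r0 * w2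
        - 3 * r0 * w3 - r1 * w2 - r1 * w3 + 2 * r2 * w0 + r2 * w1 + 3 * r3 * w0 + r3 * w1,
      2 * C * r1 * w3 + 2 * C * r2 * w3 - 2 * C * r3 * w1 - 2 * C * r3 * w2 + G * r0 * w3 + G * r1 * w2
        + 3 * G * r1 * w3 + G * r2 * w1 + 2 * G * r2 * w2 + 3 * G * r2 * w3 + G * r3 * w0 + G * r3 * w1
        + G * r3 * w2 + G * r3 * w3 - 3 * r0 * w3 - r1 * w2 - 3 * r1 * w3 + r2 * w1 - r2 * w3 + 3 * r3 * w0
        + 3 * r3 * w1 + r3 * w2,
      C * r2 * w3 - C * r3 * w2 + G * r1 * w3 + G * r2 * w2 + 3 * G * r2 * w3 + G * r3 * w1 + 2 * G * r3 * w2
        + 3 * G * r3 * w3 - 2 * r1 * w3 - 2 * r2 * w3 + 2 * r3 * w1 + 2 * r3 * w2,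
      G * r2 * w3 + G * r3 * w2 + 3 * G * r3 * w3 - r2 * w3 + r3 * w2,
      G * r3 * w3:]"
  have S: "poly S z = (C + G - z) * W (z + 1) * Q z - (C - z) * W z * Q (z + 1)" for z
    unfolding S_def W Q by (simp add: power2_eq_square power3_eq_cube algebra_simps)
  have "S = 0"
  proof (rule ccontr)
    assume "S \<noteq> 0"
    have "A \<subseteq> {z. poly S z = 0}" using rec by (auto simp: S)
    then have "card A \<le> card {z. poly S z = 0}"
      by (rule card_mono[OF poly_roots_finite[OF \<open>S \<noteq> 0\<close>]])
    also have "\<dots> \<le> degree S" by (rule card_poly_roots_bound[OF \<open>S \<noteq> 0\<close>])
    also have "\<dots> \<le> 6" unfolding S_def by (rule degree_le) (auto simp: coeff_pCons split: nat.splits)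
    finally show False using A(2) by simp
  qed
  then have c: "coeff S i = 0" for i by simp
  have "G * r3 * w3 = 0" using c[of 6] unfolding S_def by (simp add: coeff_pCons eval_nat_numeral)
  then have 3: "r3 = 0" using W(2) G by simp
  have "(G - 1) * r2 * w3 = 0"
    using c[of 5] unfolding S_def 3 by (simp add: coeff_pCons eval_nat_numeral algebra_simps)
  then have 2: "r2 = 0" using W(2) G by simp
  have "(G - 2) * r1 * w3 = 0"
    using c[of 4] unfolding S_def 3 2 by (simp add: coeff_pCons eval_nat_numeral algebra_simps)
  then have 1: "r1 = 0" using W(2) G by simp
  have "(G - 3) * r0 * w3 = 0"
    using c[of 3] unfolding S_def 3 2 1 by (simp add: coeff_pCons eval_nat_numeral algebra_simps)
  then have 0: "r0 = 0" using W(2) G by simp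
  show ?thesis unfolding Q 0 1 2 3 by simp
qed

section \<open>Symmetric sets for which the leading coefficient vanishes\<close>

context nodes
begin

lemma weight_uminus:
  assumes "uminus ` X = X" "b \<in> X"
  shows "weight (- b) = (- 1) ^ c * weight b"
proof -
  have "(\<Prod>b'\<in>X - {- b}. - b - b') = (\<Prod>b'\<in>X - {b}. - (b - b'))"
    using assms
    by (intro prod.reindex_bij_witness[of _ uminus uminus]) auto
  also have "\<dots> = (- 1) ^ c * (\<Prod>b'\<in>X - {b}. b - b')"
    by (subst prod_uminus) (use assms(2) card_X in simp)
  finally show ?thesis
    by (cases "even c") (simp_all add: weight_def)
qed

lemma moment_parity:
  assumes "uminus ` X = X" "(2::'a) \<noteq> 0" "odd (c + i)"
  shows "moment i = 0"
proof -
  have "moment i = (\<Sum>b\<in>X. weight (- b) * (- b) ^ i)"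
    unfolding moment_def using assms(1)
    by (intro sum.reindex_bij_witness[of _ uminus uminus]) auto
  also have "\<dots> = (\<Sum>b\<in>X. - (weight b * b ^ i))"
    using assms(3) by (intro sum.cong refl) (cases "even i"; simp add: weight_uminus[OF assms(1)])
  also have "\<dots> = - moment i" by (simp add: moment_def sum_negf)
  finally have "2 * moment i = 0" by (simp add: eq_neg_iff_add_eq_0)
  with assms(2) show ?thesis by simp
qed

text \<open>The divided difference of \<open>x\<^sup>c \<Prod>b\<in>X. (x - b)\<close> is 0. If all the moments in question vanished, it would equal
  the constant term of the product, which is nonzero.\<close>

lemma exists_gap_end:
  assumes "0 \<notin> X"
  shows "\<exists>j. 0 < j \<and> j \<le> Suc c \<and> moment (c + j) \<noteq> 0"
proof (rule ccontr)
  assume "\<not> ?thesis"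
  then have z: "moment (c + j) = 0" if "0 < j" "j \<le> Suc c" for j using that by blast
  define f where "f = (\<Prod>b\<in>X. [:- b, 1:])"
  have deg: "degree f = Suc c" unfolding f_def by (subst degree_prod_eq_sum_degree) (auto simp: card_X)
  have "0 = (\<Sum>b\<in>X. weight b * (b ^ c * poly f b))"
    by (rule sum.neutral[symmetric]) (auto simp: f_def poly_prod)
  also have "\<dots> = (\<Sum>b\<in>X. \<Sum>i\<le>Suc c. coeff f i * (weight b * b ^ (c + i)))"
    unfolding poly_altdef deg by (simp only: sum_distrib_left power_add mult_ac)
  also have "\<dots> = (\<Sum>i\<le>Suc c. coeff f i * moment (c + i))"
    unfolding moment_def by (subst sum.swap) (simp only: sum_distrib_left)
  also have "\<dots> = coeff f 0 * moment (c + 0)"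
    by (subst sum.remove[of _ 0], simp, simp, subst sum.neutral) (auto simp: z)
  finally have "poly f 0 = 0" by (simp add: moment_top poly_0_coeff_0)
  then show False using assms by (auto simp: f_def poly_prod)
qed

end

text \<open>The exceptional situation, with \<open>g\<close> the length of the first gap in the moments. It is contradictory; the
  lemmas of this locale lead to that contradiction. Throughout, \<open>y = c - 1\<close> and \<open>L = 4 c - 6\<close>.\<close>

locale residual_nodes = gapped_nodes X c g for X :: "'a::field set" and c g +
  fixes n p :: nat
  assumes c_eq: "c = 2 * n + 1" and n: "2 \<le> n"
    and p: "prime p" "p = CHAR('a)" "8 * n + 7 \<le> p"
    and y: "8 * (of_nat (2 * n) * of_nat (2 * n)) = (1::'a)"
    and g_le: "g \<le> 2 * n + 2" and g_even: "even g"
    and gap_end: "moment (c + g) \<noteq> 0"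
    and symmetric: "uminus ` X = X"
    and small: "card (noncancelling_sums X) \<le> 8 * n - 2"
begin

abbreviation y :: 'a where "y \<equiv> of_nat (2 * n)"
abbreviation G :: 'a where "G \<equiv> of_nat g"
abbreviation L :: nat where "L \<equiv> 8 * n - 2"

lemma char_above_p: "N < p \<Longrightarrow> char_above TYPE('a) N"
  using p(2) by (auto simp: char_above_def of_nat_eq_0_iff_char_dvd dest: dvd_imp_le)

lemma nonzero: "0 < i \<Longrightarrow> i < p \<Longrightarrow> of_nat i \<noteq> (0::'a)"
  using char_above_p[of i] by (auto simp: char_above_def)

lemma numerals_nonzero: "(2::'a) \<noteq> 0" "(3::'a) \<noteq> 0" "(5::'a) \<noteq> 0" "(7::'a) \<noteq> 0"
  using nonzero[of 2] nonzero[of 3] nonzero[of 5] nonzero[of 7] p n by simp_all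

lemma of_nat_c: "of_nat c = y + 1"
  by (simp add: c_eq)

lemma y_simps: "y \<noteq> 0" "y + 1 \<noteq> 0" "2 * y + 1 \<noteq> 0" "4 * y + 1 \<noteq> 0"
  using nonzero[of "2 * n"] nonzero[of "2 * n + 1"] nonzero[of "4 * n + 1"] nonzero[of "8 * n + 1"] p n
  by (simp_all add: add_ac)

lemma inv_fact_ne: "0 \<le> z \<Longrightarrow> z < int p \<Longrightarrow> inv_fact z \<noteq> (0::'a)"
  using inv_fact_nonzero[OF char_above_p, of "p - 1" z] p n by simp

lemma fact_ne: "N < p \<Longrightarrow> of_nat (fact N) \<noteq> (0::'a)"
  using of_nat_fact_nonzero[OF char_above_p] by blast

lemma axis: "top_coeff (y + 1 + z) (y + 1) (y + 1) (y + 1) = axis_coeff y z"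
  unfolding axis_coeff_def by (rule top_coeff_axis[OF y])

lemma \<Psi>_base:
  assumes "a \<le> c" "K + a = L"
  shows "\<Psi> K a = of_nat (fact K) * (inv_fact (int c - int a) * inv_fact (int c) ^ 3 * axis_coeff y (- of_nat a))"
proof -
  have "char_above TYPE('a) c" by (rule char_above_p) (use p c_eq in simp)
  moreover have "K + a + 6 = 4 * c" using assms(2) n by (simp add: c_eq)
  ultimately have "\<Psi> K a = of_nat (fact K) * (inv_fact (int c - int a) * inv_fact (int c) ^ 3 *
      top_coeff (y + 1 + (- of_nat a)) (y + 1) (y + 1) (y + 1))"
    using \<Psi>_at[of K a] unfolding of_nat_c by (simp only: diff_conv_add_uminus)
  then show ?thesis unfolding axis .
qed

text \<open>\<open>E\<close> is the coefficient of degree \<open>L - g\<close> of an even annihilating polynomial. The coefficients of the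
  degrees in between are 0: those at odd distance from \<open>L\<close> by evenness, the others by the relation with
  \<open>a = 2\<close> and smaller excess degree, as \<open>axis_coeff y (- 2) \<noteq> 0\<close>.\<close>

lemma gap_relation:
  obtains E where "\<And>a. a \<le> g \<Longrightarrow>
    moment (c + g) * of_nat (fact (L + g - a)) *
      (inv_fact (int c + int g - int a) * inv_fact (int c) * axis_coeff y (G - of_nat a) +
       3 * inv_fact (int c - int a) * inv_fact (int c + int g) *
         top_coeff (y + 1 - of_nat a) (y + 1 + G) (y + 1) (y + 1)) +
    E * of_nat (fact (L - a)) * inv_fact (int c - int a) * inv_fact (int c) * axis_coeff y (- of_nat a) = 0"
proof -
  have gL: "g \<le> L" using g_le n by simp
  have L6: "L + 6 = 4 * c" using n by (simp add: c_eq)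
  obtain q where q0: "q 0 = 1" and q_odd: "\<And>i. odd i \<Longrightarrow> q i = 0"
    and ann: "\<And>s. s \<in> noncancelling_sums X \<Longrightarrow> (\<Sum>i\<le>L. q i * s ^ (L - i)) = 0"
    using even_monic_annihilator[OF finite_noncancelling_sums[OF fin] small _ noncancelling_sums_uminus[OF symmetric] numerals_nonzero(1)]
    by auto
  have \<Psi>_sum: "(\<Sum>i\<le>d. q i * \<Psi> (L + d - a - i) a) = 0" if "a \<le> d" "d \<le> g" for a d
  proof -
    have "0 = (\<Sum>i\<le>L. q i * \<Psi> (d - a + (L - i)) a)"
      using annihilator_\<Psi>[where q = q and L = L and b = "d - a" and a = a] ann by simp
    also have "\<dots> = (\<Sum>i\<le>d. q i * \<Psi> (d - a + (L - i)) a)"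
      by (rule sum.mono_neutral_right) (use that gL L6 in \<open>auto intro!: \<Psi>_low\<close>)
    also have "\<dots> = (\<Sum>i\<le>d. q i * \<Psi> (L + d - a - i) a)"
      by (rule sum.cong) (use that gL in \<open>auto intro!: arg_cong2[where f = \<Psi>]\<close>)
    finally show ?thesis by simp
  qed
  have q_gap: "q d = 0" if "0 < d" "d < g" for d
  proof (cases "even d")
    case True
    with that have d2: "2 \<le> d" by presburger
    have "0 = (\<Sum>i\<le>d. q i * \<Psi> (L + d - 2 - i) 2)" using \<Psi>_sum[of 2 d] d2 that by simp
    also have "\<dots> = (\<Sum>i\<in>{d}. q i * \<Psi> (L + d - 2 - i) 2)"
      by (rule sum.mono_neutral_right) (use d2 that gL L6 in \<open>auto intro!: \<Psi>_gap_zero\<close>)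
    also have "\<dots> = q d * \<Psi> (L - 2) 2" by simp
    finally have "q d * \<Psi> (L - 2) 2 = 0" by simp
    moreover have "\<Psi> (L - 2) 2 \<noteq> 0"
    proof -
      have "axis_coeff y (- 2) = - (2 * 2 * 2 * 3 * (y + 1) * (y + 1) * y)"
        by (simp add: axis_coeff_def algebra_simps)
      then have "axis_coeff y (- 2) \<noteq> 0" using y_simps numerals_nonzero
        by (simp only: neg_equal_0_iff_equal mult_eq_0_iff simp_thms)
      moreover have "of_nat (fact (L - 2)) \<noteq> (0::'a)" by (rule fact_ne) (use p in simp)
      moreover have "inv_fact (int c - 2) \<noteq> (0::'a)" "inv_fact (int c) \<noteq> (0::'a)"
        by (rule inv_fact_ne; use p n c_eq in simp)+
      ultimately show ?thesis
        using \<Psi>_base[of 2 "L - 2"] n c_eq by (simp del: of_nat_fact)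
    qed
    ultimately show ?thesis by simp
  qed (rule q_odd)
  have rel: "\<Psi> (L + g - a) a + q g * \<Psi> (L - a) a = 0" if "a \<le> g" for a
  proof -
    have "0 = (\<Sum>i\<le>g. q i * \<Psi> (L + g - a - i) a)" using \<Psi>_sum[of a g] that by simp
    also have "\<dots> = (\<Sum>i\<in>{0, g}. q i * \<Psi> (L + g - a - i) a)"
      by (rule sum.mono_neutral_right) (use q_gap in auto)
    also have "\<dots> = \<Psi> (L + g - a) a + q g * \<Psi> (L - a) a"
      using g_pos q0 by (simp add: algebra_simps)
    finally show ?thesis by simp
  qed
  show ?thesis
  proof (rule that[of "q g"])
    fix a assume a: "a \<le> g"
    have ivc: "inv_fact (int c) \<noteq> (0::'a)" by (rule inv_fact_ne) (use p c_eq in simp_all)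
    have base: "\<Psi> (L - a) a = of_nat (fact (L - a)) *
        (inv_fact (int c - int a) * inv_fact (int c) ^ 3 * axis_coeff y (- of_nat a))"
    proof (cases "a \<le> c")
      case True
      show ?thesis by (rule \<Psi>_base[OF True]) (use a gL in simp)
    next
      case False
      have "char_above TYPE('a) c" by (rule char_above_p) (use p c_eq in simp)
      from \<Psi>_at[OF this, of "L - a" a] False show ?thesis using a gL L6 by simp
    qed
    have cg: "char_above TYPE('a) (c + g)" by (rule char_above_p) (use p c_eq g_le n in simp)
    have e: "y + 1 + G - of_nat a = y + 1 + (G - of_nat a)" by simp
    have gapv: "\<Psi> (L + g - a) a = moment (c + g) * of_nat (fact (L + g - a)) * inv_fact (int c) ^ 2 *
       (inv_fact (int c + int g - int a) * inv_fact (int c) * axis_coeff y (G - of_nat a) +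
        3 * inv_fact (int c - int a) * inv_fact (int c + int g) *
         top_coeff (y + 1 - of_nat a) (y + 1 + G) (y + 1) (y + 1))"
      using \<Psi>_gap[OF cg, of "L + g - a" a] a gL L6 unfolding of_nat_c e axis by simp
    have "inv_fact (int c) ^ 2 * (moment (c + g) * of_nat (fact (L + g - a)) *
      (inv_fact (int c + int g - int a) * inv_fact (int c) * axis_coeff y (G - of_nat a) +
       3 * inv_fact (int c - int a) * inv_fact (int c + int g) *
         top_coeff (y + 1 - of_nat a) (y + 1 + G) (y + 1) (y + 1)) +
      q g * of_nat (fact (L - a)) * inv_fact (int c - int a) * inv_fact (int c) * axis_coeff y (- of_nat a)) = 0"
      (is "_ * ?E = 0")
      using rel[OF a] unfolding base gapv
      by (simp only: distrib_left power2_eq_square power3_eq_cube mult_ac)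
    with ivc show "?E = 0" by simp
  qed
qed

text \<open>Writing both inverse factorials that depend on \<open>a\<close> as falling factorials times fixed ones leaves
  polynomials in \<open>y\<close> and \<open>G\<close> beside the two factorials; \<open>N\<close> is the unknown to be eliminated.\<close>

lemma normalized_relation:
  obtains M N where "M \<noteq> 0" "\<And>a. a \<le> g \<Longrightarrow> a \<le> c \<Longrightarrow>
    M * of_nat (fact (L + g - a)) * gap_term y G a + N * of_nat (fact (L - a)) * base_term y a = 0"
proof -
  obtain E where E: "\<And>a. a \<le> g \<Longrightarrow>
    moment (c + g) * of_nat (fact (L + g - a)) *
      (inv_fact (int c + int g - int a) * inv_fact (int c) * axis_coeff y (G - of_nat a) +
       3 * inv_fact (int c - int a) * inv_fact (int c + int g) *
         top_coeff (y + 1 - of_nat a) (y + 1 + G) (y + 1) (y + 1)) +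
    E * of_nat (fact (L - a)) * inv_fact (int c - int a) * inv_fact (int c) * axis_coeff y (- of_nat a) = 0"
    using gap_relation by blast
  have cg: "char_above TYPE('a) (c + g)" by (rule char_above_p) (use p c_eq g_le n in simp)
  show ?thesis
  proof (rule that[of "moment (c + g) * inv_fact (int c) * inv_fact (int c + int g)" "E * inv_fact (int c) ^ 2"])
    show "moment (c + g) * inv_fact (int c) * inv_fact (int c + int g) \<noteq> 0"
      using gap_end inv_fact_ne[of "int c"] inv_fact_ne[of "int c + int g"] p c_eq g_le n by simp
  next
    fix a assume "a \<le> g" "a \<le> c"
    have 1: "inv_fact (int c + int g - int a) = falling (y + 1 + G) a * (inv_fact (int c + int g) :: 'a)"
      using inv_fact_diff[OF cg, of "int c + int g" a] by (simp add: c_eq add_ac)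
    have 2: "inv_fact (int c - int a) = falling (y + 1) a * (inv_fact (int c) :: 'a)"
      using inv_fact_diff[OF cg, of "int c" a] by (simp add: c_eq add_ac)
    show "moment (c + g) * inv_fact (int c) * inv_fact (int c + int g) * of_nat (fact (L + g - a)) * gap_term y G a +
        E * inv_fact (int c) ^ 2 * of_nat (fact (L - a)) * base_term y a = 0"
      using E[OF \<open>a \<le> g\<close>] unfolding 1 2 gap_term_def base_term_def
      by (simp only: distrib_left power2_eq_square mult_ac)
  qed
qed

lemma eliminate:
  assumes "m * r * A + k * s * B = (0::'a)" "m * A' + k * B' = 0" "m \<noteq> 0"
  shows "r * A * B' = s * A' * B"
proof -
  have "m * (r * A * B' - s * A' * B) = (m * r * A + k * s * B) * B' - s * B * (m * A' + k * B')"
    by (simp add: algebra_simps)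
  then show ?thesis using assms by simp
qed

lemma of_nat_L: "of_nat L = 4 * y - 2"
  using n by (simp add: of_nat_diff)

lemma fact_step:
  "Suc N = K \<Longrightarrow> of_nat (fact K) = of_nat (fact N) * (of_nat K :: 'a)"
  by (metis fact_Suc mult.commute of_nat_id of_nat_mult)

lemma fact_top:
  assumes "Suc j \<le> K"
  shows "of_nat (fact (K - j)) = of_nat (fact (K - Suc j)) * (of_nat K - of_nat j :: 'a)"
  using fact_step[of "K - Suc j" "K - j"] assms by (simp add: of_nat_diff Suc_diff_Suc del: of_nat_fact)

lemma of_nat_Lg: "of_nat (L + g) = 4 * y - 2 + G"
  unfolding of_nat_add of_nat_L ..

text \<open>Elimination of \<open>N\<close> from the relations for \<open>a = 2\<close> and \<open>a = 3\<close>. Only \<open>(L + g - 3)!\<close> has to be invertible,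
  so this covers \<open>L + g = p + 1\<close> as well.\<close>

lemma relation_2_3:
  assumes "3 \<le> g" "L + g - 3 < p"
  shows "(4 * y - 2 + G - 2) * gap_term y G 2 * base_term y 3 = (4 * y - 2 - 2) * gap_term y G 3 * base_term y 2"
proof -
  obtain M N where M: "M \<noteq> 0" and E: "\<And>a. a \<le> g \<Longrightarrow> a \<le> c \<Longrightarrow>
    M * of_nat (fact (L + g - a)) * gap_term y G a + N * of_nat (fact (L - a)) * base_term y a = 0"
    using normalized_relation by blast
  have f: "of_nat (fact (L + g - 2)) = of_nat (fact (L + g - 3)) * (4 * y - 2 + G - 2 :: 'a)"
    using fact_top[of 2 "L + g"] assms unfolding of_nat_Lg by (simp del: of_nat_fact)
  have f': "of_nat (fact (L - 2)) = of_nat (fact (L - 3)) * (4 * y - 2 - 2 :: 'a)"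
    using fact_top[of 2 L] n unfolding of_nat_L by (simp del: of_nat_fact)
  have "M * of_nat (fact (L + g - 3)) \<noteq> 0" using M fact_ne[OF assms(2)] by (simp del: of_nat_fact)
  moreover have "M * of_nat (fact (L + g - 2)) * gap_term y G 2 + N * of_nat (fact (L - 2)) * base_term y 2 = 0"
    by (rule E) (use assms c_eq n in simp_all)
  moreover have "M * of_nat (fact (L + g - 3)) * gap_term y G 3 + N * of_nat (fact (L - 3)) * base_term y 3 = 0"
    by (rule E) (use assms c_eq n in simp_all)
  ultimately show ?thesis unfolding f f' 
    by (intro eliminate[where m = "M * of_nat (fact (L + g - 3))" and k = "N * of_nat (fact (L - 3))"])
      (simp_all only: mult.assoc not_False_eq_True)
qed

lemma relation_2_4:
  assumes "4 \<le> g" "L + g - 4 < p"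
  shows "(4 * y - 2 + G - 2) * (4 * y - 2 + G - 3) * gap_term y G 2 * base_term y 4 =
    (4 * y - 2 - 2) * (4 * y - 2 - 3) * gap_term y G 4 * base_term y 2"
proof -
  obtain M N where M: "M \<noteq> 0" and E: "\<And>a. a \<le> g \<Longrightarrow> a \<le> c \<Longrightarrow>
    M * of_nat (fact (L + g - a)) * gap_term y G a + N * of_nat (fact (L - a)) * base_term y a = 0"
    using normalized_relation by blast
  have f: "of_nat (fact (L + g - 2)) =
      of_nat (fact (L + g - 4)) * ((4 * y - 2 + G - 2) * (4 * y - 2 + G - 3) :: 'a)"
    using fact_top[of 2 "L + g"] fact_top[of 3 "L + g"] assms unfolding of_nat_Lg
    by (simp add: mult_ac del: of_nat_fact)
  have f': "of_nat (fact (L - 2)) = of_nat (fact (L - 4)) * ((4 * y - 2 - 2) * (4 * y - 2 - 3) :: 'a)"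
    using fact_top[of 2 L] fact_top[of 3 L] n unfolding of_nat_L by (simp add: mult_ac del: of_nat_fact)
  have "M * of_nat (fact (L + g - 4)) \<noteq> 0" using M fact_ne[OF assms(2)] by (simp del: of_nat_fact)
  moreover have "M * of_nat (fact (L + g - 2)) * gap_term y G 2 + N * of_nat (fact (L - 2)) * base_term y 2 = 0"
    by (rule E) (use assms c_eq n in simp_all)
  moreover have "M * of_nat (fact (L + g - 4)) * gap_term y G 4 + N * of_nat (fact (L - 4)) * base_term y 4 = 0"
    by (rule E) (use assms c_eq n in simp_all)
  ultimately show ?thesis unfolding f f' 
    by (intro eliminate[where m = "M * of_nat (fact (L + g - 4))" and k = "N * of_nat (fact (L - 4))"])
      (simp_all only: mult.assoc not_False_eq_True)
qed

text \<open>For \<open>a = 0\<close> the relation reads \<open>axis_coeff y G = 0\<close>, because \<open>axis_coeff y 0 = 0\<close>. Its only root that \<open>g\<close> can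
  represent is \<open>G = 1 - 6 y\<close>.\<close>

lemma not_small_gap: "\<not> L + g < p"
proof
  assume lt: "L + g < p"
  obtain M N where M: "M \<noteq> 0" and E: "\<And>a. a \<le> g \<Longrightarrow> a \<le> c \<Longrightarrow>
    M * of_nat (fact (L + g - a)) * gap_term y G a + N * of_nat (fact (L - a)) * base_term y a = 0"
    using normalized_relation by blast
  have "base_term y 0 = 0" by (simp add: base_term_def axis_coeff_def)
  moreover have "gap_term y G 0 = 4 * axis_coeff y G"
    using axis[of G] top_coeff_swap(3)[of "y + 1" "y + 1 + G" "y + 1" "y + 1"]
    by (simp add: gap_term_def)
  moreover have "(4::'a) \<noteq> 0" using numerals_nonzero(1) power_not_zero[of "2::'a" 2] by simp
  ultimately have "axis_coeff y G = 0" using E[of 0] M fact_ne[OF lt] by (simp del: of_nat_fact)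
  moreover have "G \<noteq> 0" "G + 1 \<noteq> 0"
    using nonzero[of g] nonzero[of "Suc g"] lt g_pos n by (simp_all add: add_ac)
  ultimately have "(4 * y + 1) * G + 2 * (y + 1) = 0"
    using y_simps numerals_nonzero unfolding axis_coeff_def by (simp only: mult_eq_0_iff simp_thms)
  moreover have "(4 * y - 1) * ((4 * y + 1) * G + 2 * (y + 1)) =
      (2 * (8 * (y * y)) - 1) * G + 8 * (y * y) + 6 * y - 2"
    by (simp only: algebra_simps) simp
  ultimately have "(2 * 1 - 1) * G + 1 + 6 * y - 2 = 0" unfolding y by simp
  then have G: "G = 1 - 6 * y" by (simp add: algebra_simps eq_diff_eq)
  have "g \<noteq> 2"
  proof
    assume "g = 2"
    with G have "6 * y = - 1" by (simp add: algebra_simps eq_neg_iff_add_eq_0)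
    then have "8 * ((6 * y) * (6 * y)) = (8 :: 'a)" by simp
    moreover have "8 * ((6 * y) * (6 * y)) = 36 * (8 * (y * y))" by simp
    ultimately have "36 - 8 = (0::'a)" unfolding y by simp
    moreover have "2 * 2 * 7 = (36 - 8 :: 'a)" by simp
    ultimately have "2 * 2 * 7 = (0::'a)" by simp
    then show False using numerals_nonzero by (simp only: mult_eq_0_iff simp_thms)
  qed
  with g_even g_pos have g4: "4 \<le> g" by presburger
  show False
    using resonance_elimination[OF y numerals_nonzero(1,2,4)] relation_2_3 relation_2_4 g4 lt
    unfolding G by simp
qed

text \<open>Now \<open>L + g\<close> is 1 in the field, which determines \<open>G\<close>. The relations for \<open>a = 0\<close> and \<open>a = 1\<close> hold
  trivially, so those for \<open>a = 2\<close> and \<open>a = 3\<close> are used.\<close>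

lemma not_boundary_gap: "L + g \<noteq> p + 1"
proof
  assume eq: "L + g = p + 1"
  have "of_nat (L + g) = (1::'a)" unfolding eq using p(2) by simp
  then have "4 * y - 2 + G = 1" unfolding of_nat_add of_nat_L .
  then have G: "G = 3 - 4 * y" by (simp add: algebra_simps eq_diff_eq)
  have "3 \<le> g" "L + g - 3 < p" using eq p(3) by linarith+
  from relation_2_3[OF this] show False
    using boundary_elimination[OF y numerals_nonzero] unfolding G by simp
qed

text \<open>Here \<open>(L + g - 2)!\<close> vanishes in the field, so \<open>E = 0\<close>. For \<open>a > L + g - p\<close> the factorial is invertible and
  the relation expresses the quotient of \<open>W a = axis_coeff y (G - a)\<close> and \<open>Q a\<close> by inverse factorials;
  hence \<open>W\<close> and \<open>Q\<close> satisfy the first-order recurrence of \<open>shift_recurrence_cubic\<close>. As \<open>p \<ge> 8 n + 7\<close>,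
  there are enough such \<open>a\<close> below \<open>g\<close>.\<close>

lemma not_large_gap: "\<not> p + 2 \<le> L + g"
proof
  assume ge: "p + 2 \<le> L + g"
  have g11: "11 \<le> g" using ge p(3) n by linarith
  obtain E where E: "\<And>a. a \<le> g \<Longrightarrow>
    moment (c + g) * of_nat (fact (L + g - a)) *
      (inv_fact (int c + int g - int a) * inv_fact (int c) * axis_coeff y (G - of_nat a) +
       3 * inv_fact (int c - int a) * inv_fact (int c + int g) *
         top_coeff (y + 1 - of_nat a) (y + 1 + G) (y + 1) (y + 1)) +
    E * of_nat (fact (L - a)) * inv_fact (int c - int a) * inv_fact (int c) * axis_coeff y (- of_nat a) = 0"
    using gap_relation by blast
  have "E = 0"
  proof -
    have "of_nat (fact (L + g - 2)) = (0::'a)"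
      using prime_dvd_fact_iff[OF p(1), of "L + g - 2"] ge p(2)
      by (simp only: of_nat_eq_0_iff_char_dvd)
    then have "E * of_nat (fact (L - 2)) * inv_fact (int c - int 2) * inv_fact (int c) * axis_coeff y (- of_nat 2) = 0"
      using E[of 2] g11 by (simp del: of_nat_fact)
    moreover have "axis_coeff y (- of_nat 2) = - (2 * 2 * 2 * 3 * (y + 1) * (y + 1) * y)"
      by (simp add: axis_coeff_def algebra_simps)
    moreover have "2 * 2 * 2 * 3 * (y + 1) * (y + 1) * y \<noteq> (0::'a)" using y_simps numerals_nonzero
      by (simp only: mult_eq_0_iff simp_thms not_False_eq_True)
    moreover have "inv_fact (int c - int 2) \<noteq> (0::'a)" "inv_fact (int c) \<noteq> (0::'a)"
      by (rule inv_fact_ne; use p n c_eq in simp)+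
    moreover have "of_nat (fact (L - 2)) \<noteq> (0::'a)" by (rule fact_ne) (use p in simp)
    ultimately show ?thesis by (simp only: mult_eq_0_iff neg_equal_0_iff_equal) blast
  qed
  define a0 where "a0 = L + g + 1 - p"
  define W where "W z = axis_coeff y (G - z)" for z
  define Q where "Q z = top_coeff (y + 1 - z) (y + 1 + G) (y + 1) (y + 1)" for z
  have rel: "inv_fact (int c + int g - int a) * inv_fact (int c) * W (of_nat a) +
      3 * inv_fact (int c - int a) * inv_fact (int c + int g) * Q (of_nat a) = 0"
    if "a0 \<le> a" "a \<le> g" for a
    using E[OF that(2)] \<open>E = 0\<close> gap_end fact_ne[of "L + g - a"] that(1) ge p(3)
    unfolding Q_def W_def a0_def by (simp del: of_nat_fact)
  have rec: "(y + 1 + G - of_nat a) * W (of_nat a + 1) * Q (of_nat a) =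
      (y + 1 - of_nat a) * W (of_nat a) * Q (of_nat a + 1)"
    if "a0 \<le> a" "a < g" for a
  proof -
    have cg: "char_above TYPE('a) (c + g)" by (rule char_above_p) (use p c_eq g_le n in simp)
    have 1: "inv_fact (int c + int g - int (Suc a)) = (y + 1 + G - of_nat a) * (inv_fact (int c + int g - int a) :: 'a)"
      using inv_fact_pred[OF cg, of "int c + int g - int a"] of_nat_c by (simp add: diff_diff_eq add_ac)
    have 2: "inv_fact (int c - int (Suc a)) = (y + 1 - of_nat a) * (inv_fact (int c - int a) :: 'a)"
      using inv_fact_pred[OF cg, of "int c - int a"] of_nat_c by (simp add: diff_diff_eq add_ac)
    have ne: "inv_fact (int c + int g - int a) * inv_fact (int c) \<noteq> (0::'a)"
      using inv_fact_ne[of "int c + int g - int a"] inv_fact_ne[of "int c"] that p c_eq g_le n by simp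
    have s: "of_nat (Suc a) = (of_nat a + 1 :: 'a)" by simp
    have "inv_fact (int c + int g - int a) * inv_fact (int c) * (y + 1 + G - of_nat a) * W (of_nat a + 1) +
      3 * inv_fact (int c - int a) * inv_fact (int c + int g) * (y + 1 - of_nat a) * Q (of_nat a + 1) = 0"
      using rel[of "Suc a"] that unfolding 1 2 s by (simp only: Suc_leI le_SucI mult_ac)
    from eliminate[OF this rel[OF that(1) less_imp_le[OF that(2)]] ne] show ?thesis
      by (simp add: mult_ac)
  qed
  obtain q0 q1 q2 q3 where q: "\<And>z. top_coeff z (y + 1 + G) (y + 1) (y + 1) = q0 + q1 * z + q2 * z ^ 2 + q3 * z ^ 3"
    using top_coeff_cubic[of "y + 1 + G" "y + 1" "y + 1"] by blast
  have Q: "Q z = (q0 + q1 * (y + 1) + q2 * (y + 1) ^ 2 + q3 * (y + 1) ^ 3) +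
      (- (q1 + 2 * q2 * (y + 1) + 3 * q3 * (y + 1) ^ 2)) * z + (q2 + 3 * q3 * (y + 1)) * z ^ 2 + (- q3) * z ^ 3" for z
    unfolding Q_def q by (simp add: algebra_simps power2_eq_square power3_eq_cube)
  \<comment> \<open>\<open>W z\<close> equals \<open>k (G - z) (G - z + 1) (u - v z)\<close>.\<close>
  define k u v where "k = 2 * (y + 1) * (y + 1)" and "u = (4 * y + 1) * G + 2 * (y + 1)" and "v = 4 * y + 1"
  have W: "W z = k * (G * (G + 1) * u) + (- (k * ((2 * G + 1) * u + G * (G + 1) * v))) * z +
      k * (u + (2 * G + 1) * v) * z ^ 2 + (- (k * v)) * z ^ 3" for z
  proof -
    have "W z = k * ((G - z) * (G - z + 1) * (u - v * z))"
      unfolding W_def axis_coeff_def k_def u_def v_def by (simp add: algebra_simps)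
    then show ?thesis by (simp add: algebra_simps power2_eq_square power3_eq_cube)
  qed
  have kv: "- (k * v) \<noteq> 0"
    unfolding k_def v_def using y_simps numerals_nonzero
    by (simp only: neg_equal_0_iff_equal mult_eq_0_iff simp_thms not_False_eq_True)
  have "inj_on (of_nat :: nat \<Rightarrow> 'a) {a0..<g}"
  proof (rule inj_onI)
    have *: False if "i < j" "j < g" "of_nat i = (of_nat j :: 'a)" for i j
    proof -
      have "0 < j - i" "j - i < p" using that g_le p(3) by linarith+
      from nonzero[OF this] that show False by (simp add: of_nat_diff)
    qed
    fix i j assume "i \<in> {a0..<g}" "j \<in> {a0..<g}" "of_nat i = (of_nat j :: 'a)"
    then show "i = j" using *[of i j] *[of j i] by (cases i j rule: linorder_cases) auto
  qed
  then have card: "card ((of_nat :: nat \<Rightarrow> 'a) ` {a0..<g}) = g - a0" by (simp add: card_image)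
  have Gj: "G \<noteq> of_nat j" if "j \<le> 3" for j
  proof -
    have "0 < g - j" "g - j < p" using that g11 g_le p(3) by linarith+
    from nonzero[OF this] that g11 show ?thesis by (simp add: of_nat_diff)
  qed
  have "Q z = 0" for z
  proof (rule shift_recurrence_cubic[OF _ _ W kv Q, where A = "of_nat ` {a0..<g}" and C = "y + 1" and G = G])
    have "7 \<le> g - a0" unfolding a0_def using ge p(3) n by linarith
    then show "7 \<le> card ((of_nat :: nat \<Rightarrow> 'a) ` {a0..<g})" by (simp only: card)
    show "G \<noteq> 0" "G \<noteq> 1" "G \<noteq> 2" "G \<noteq> 3" using Gj[of 0] Gj[of 1] Gj[of 2] Gj[of 3] by simp_all
    fix z :: 'a assume "z \<in> of_nat ` {a0..<g}"
    then obtain a where "z = of_nat a" "a0 \<le> a" "a < g" by auto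
    with rec[of a] show "(y + 1 + G - z) * W (z + 1) * Q z = (y + 1 - z) * W z * Q (z + 1)" by simp
  qed simp
  moreover have "a0 \<le> g - 1" using p(3) n by (simp add: a0_def)
  ultimately have "inv_fact (int c + int g - int (g - 1)) * inv_fact (int c) * W (of_nat (g - 1)) = 0"
    using rel[of "g - 1"] by simp
  moreover have "inv_fact (int c + int g - int (g - 1)) * inv_fact (int c) \<noteq> (0::'a)"
    using inv_fact_ne[of "int c + int g - int (g - 1)"] inv_fact_ne[of "int c"] p c_eq g11 n by simp
  ultimately have "axis_coeff y 1 = 0" unfolding W_def using g11 by (simp add: of_nat_diff)
  moreover have "axis_coeff y 1 = 2 * 2 * 3 * (y + 1) * (y + 1) * (2 * y + 1)"
    by (simp add: axis_coeff_def algebra_simps)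
  ultimately show False using y_simps numerals_nonzero by (simp only: mult_eq_0_iff simp_thms)
qed

lemma contradiction: False
proof -
  have "even (L + g)" using g_even by simp
  moreover have "odd p" using p(1,3) n prime_odd_nat[of p] by simp
  ultimately have "L + g \<noteq> p" by auto
  then show False using not_small_gap not_boundary_gap not_large_gap by linarith
qed

end

text \<open>Write \<open>p = 8 n + r\<close>. Then \<open>2 (32 n\<^sup>2 - 1) = (8 n)\<^sup>2 - 2\<close> is \<open>r\<^sup>2 - 2\<close> modulo \<open>p\<close>, and \<open>r = - 1, 1, 3, 5\<close> give
  \<open>- 1, - 1, 7, 23\<close>, none of which has a divisor \<open>p = 8 n + r\<close> with \<open>n \<ge> 2\<close>.\<close>

lemma char_gap_bound:
  fixes p n :: nat
  assumes p: "prime p" "8 * n - 2 < p" "2 \<le> n" and dvd: "p dvd 32 * n\<^sup>2 - 1"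
  shows "8 * n + 7 \<le> p"
proof (rule ccontr)
  assume "\<not> ?thesis"
  define r where "r = int p - 8 * int n"
  have "odd p" using p prime_odd_nat[of p] by simp
  then have "odd r" by (simp add: r_def)
  moreover have "- 2 < r" "r < 7" using p \<open>\<not> 8 * n + 7 \<le> p\<close> unfolding r_def by linarith+
  ultimately have "r = - 1 \<or> r = 1 \<or> r = 3 \<or> r = 5" by presburger
  then have r: "int p = 8 * int n + r" "r \<in> {-1, 1, 3, 5}" by (simp_all add: r_def)
  have "1 \<le> 32 * n\<^sup>2" using p(3) by (simp add: Suc_le_eq)
  then have a: "int p dvd 32 * (int n)\<^sup>2 - 1"
  proof -
    have "int (32 * n\<^sup>2 - 1) = 32 * (int n)\<^sup>2 - 1" using \<open>1 \<le> 32 * n\<^sup>2\<close> by (simp add: of_nat_diff)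
    then show ?thesis using dvd by (metis int_dvd_int_iff)
  qed
  have "int p dvd 2 * (32 * (int n)\<^sup>2 - 1) - (8 * int n - r) * int p"
    by (rule dvd_diff[OF dvd_mult[OF a] dvd_triv_right])
  also have "2 * (32 * (int n)\<^sup>2 - 1) - (8 * int n - r) * int p = r\<^sup>2 - 2"
    unfolding r(1) by (simp add: algebra_simps power2_eq_square)
  finally have d: "int p dvd r\<^sup>2 - 2" .
  have "r\<^sup>2 - 2 \<noteq> 0" using r(2) by auto
  from dvd_imp_le_int[OF this d] have "int p \<le> \<bar>r\<^sup>2 - 2\<bar>" by simp
  with r p(3) have "r = 5" by auto
  with \<open>int p \<le> \<bar>r\<^sup>2 - 2\<bar>\<close> have "int p \<le> 23" by simp
  with r(1) p(3) \<open>r = 5\<close> have "int p = 21" by presburger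
  with d \<open>r = 5\<close> show False by simp
qed

context nodes
begin

text \<open>Otherwise, the least positive \<open>g\<close> with \<open>moment (c + g) \<noteq> 0\<close> satisfies the assumptions of
  \<open>residual_nodes\<close>.\<close>

theorem card_noncancelling_sums_residual:
  assumes c: "c = 2 * n + 1" "2 \<le> n" and p: "prime CHAR('a)" "8 * n - 2 < CHAR('a)"
    and dvd: "CHAR('a) dvd 32 * n\<^sup>2 - 1"
    and X: "uminus ` X = X" "0 \<notin> X"
  shows "8 * n - 1 \<le> card (noncancelling_sums X)"
proof (rule ccontr)
  assume small: "\<not> ?thesis"
  define P where "P j \<longleftrightarrow> 0 < j \<and> moment (c + j) \<noteq> 0" for j
  define g where "g = (LEAST j. P j)"
  obtain j where j: "P j" "j \<le> Suc c" using exists_gap_end[OF X(2)] unfolding P_def by blast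
  have Pg: "P g" unfolding g_def using j(1) by (rule LeastI)
  have gle: "g \<le> Suc c" unfolding g_def using Least_le[of P j] j by simp
  have gmin: "\<not> P i" if "i < g" for i using not_less_Least that unfolding g_def by blast
  have p7: "8 * n + 7 \<le> CHAR('a)" by (rule char_gap_bound[OF p c(2) dvd])
  have "of_nat 2 \<noteq> (0::'a)"
  proof
    assume "of_nat 2 = (0::'a)"
    then have "CHAR('a) dvd 2" by (simp only: of_nat_eq_0_iff_char_dvd)
    then have "CHAR('a) \<le> 2" by (rule dvd_imp_le) simp
    with p7 show False by simp
  qed
  then have two: "(2::'a) \<noteq> 0" by simp
  have ge: "even g"
  proof (rule ccontr)
    assume "odd g"
    then have "moment (c + g) = 0" by (intro moment_parity[OF X(1) two]) simp
    with Pg show False by (simp add: P_def)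
  qed
  have "1 \<le> 32 * n\<^sup>2" using c(2) by (simp add: Suc_le_eq)
  then have "(of_nat (32 * n\<^sup>2 - 1) :: 'a) = of_nat (32 * n\<^sup>2) - 1" by (simp add: of_nat_diff)
  moreover have "(of_nat (32 * n\<^sup>2 - 1) :: 'a) = 0" using dvd by (simp only: of_nat_eq_0_iff_char_dvd)
  ultimately have y: "8 * (of_nat (2 * n) * of_nat (2 * n)) = (1::'a)"
    by (simp add: power2_eq_square algebra_simps)
  interpret residual_nodes X c g n "CHAR('a)"
  proof
    show "0 < g" using Pg by (simp add: P_def)
    show "moment (c + i) = 0" if "0 < i" "i < g" for i using gmin[OF that(2)] that(1) by (simp add: P_def)
    show "moment (c + g) \<noteq> 0" using Pg by (simp add: P_def)
  qed (use c p p7 y gle ge X small in simp_all)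
  show False by (rule contradiction)
qed

end

section \<open>The least order of a finite subgroup\<close>

lemma additive_subgroup_of_nat_mult:
  fixes x :: "'a::ring_1"
  assumes "additive_subgroup H" "x \<in> H"
  shows "of_nat i * x \<in> H"
proof (induction i)
  case 0
  show ?case using assms(1) by (simp add: additive_subgroup_def)
next
  case (Suc i)
  have "x + of_nat i * x \<in> H" using assms Suc unfolding additive_subgroup_def by blast
  then show ?case by (simp add: distrib_right)
qed

lemma min_subgroup_order_char_0:
  assumes "CHAR('a::field) = 0"
  shows "min_subgroup_order TYPE('a) = \<infinity>"
proof -
  have "False" if H: "additive_subgroup H" "H \<noteq> {0}" "finite H" for H :: "'a set"
  proof -
    obtain x where x: "x \<in> H" "x \<noteq> 0" using H by (auto simp: additive_subgroup_def)
    have "of_nat i * x \<in> H" for i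
      by (rule additive_subgroup_of_nat_mult[OF H(1) x(1)])
    then have "range (\<lambda>i. of_nat i * x) \<subseteq> H" by auto
    from finite_subset[OF this H(3)] have "finite (range (\<lambda>i. of_nat i * x))" .
    moreover have "inj (\<lambda>i. of_nat i * x)"
      using assms x(2) by (auto simp: inj_on_def of_nat_eq_iff_cong_CHAR)
    ultimately have "finite (UNIV :: nat set)" by (rule finite_imageD)
    then show False by simp
  qed
  then have "{H :: 'a set. additive_subgroup H \<and> H \<noteq> {0} \<and> finite H} = {}" by blast
  then show ?thesis unfolding min_subgroup_order_def by (simp only: image_empty Inf_empty top_enat_def)
qed

text \<open>A nonzero element has \<open>CHAR('a)\<close> distinct multiples, and the multiples of 1 form a subgroup of exactly
  this order.\<close>

lemma min_subgroup_order_char_pos: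
  assumes "CHAR('a::field) > 0"
  shows "min_subgroup_order TYPE('a) = enat CHAR('a)"
proof (rule antisym)
  let ?p = "CHAR('a)"
  let ?S = "{H :: 'a set. additive_subgroup H \<and> H \<noteq> {0} \<and> finite H}"
  have inj: "inj_on (\<lambda>i. of_nat i * x) {..<?p}" if "x \<noteq> 0" for x :: 'a
  proof (rule inj_onI)
    fix i j assume ij: "i \<in> {..<?p}" "j \<in> {..<?p}" "of_nat i * x = of_nat j * x"
    then have "[i = j] (mod ?p)" using that by (simp add: of_nat_eq_iff_cong_CHAR)
    with ij show "i = j" by (simp add: cong_def)
  qed
  show "enat ?p \<le> min_subgroup_order TYPE('a)"
    unfolding min_subgroup_order_def
  proof (rule INF_greatest, clarify)
    fix H :: "'a set" assume H: "additive_subgroup H" "H \<noteq> {0}" "finite H"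
    obtain x where x: "x \<in> H" "x \<noteq> 0" using H by (auto simp: additive_subgroup_def)
    have "of_nat i * x \<in> H" for i
      by (rule additive_subgroup_of_nat_mult[OF H(1) x(1)])
    then have "(\<lambda>i. of_nat i * x) ` {..<?p} \<subseteq> H" by auto
    then have "card ((\<lambda>i. of_nat i * x) ` {..<?p}) \<le> card H" by (rule card_mono[OF H(3)])
    then show "enat ?p \<le> enat (card H)" by (simp add: card_image[OF inj[OF x(2)]])
  qed
  define H where "H = (of_nat :: nat \<Rightarrow> 'a) ` {..<?p}"
  have mem: "of_nat i \<in> H" for i
  proof -
    have "(of_nat i :: 'a) = of_nat (i mod ?p)" by (simp add: of_nat_eq_iff_cong_CHAR cong_def)
    then show ?thesis using assms by (simp add: H_def)
  qed
  have "additive_subgroup H"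
    unfolding additive_subgroup_def
  proof (intro conjI ballI)
    show "0 \<in> H" using mem[of 0] by simp
    fix x assume "x \<in> H"
    then obtain i where i: "x = of_nat i" "i < ?p" by (auto simp: H_def)
    have "- x = of_nat (?p - i)" using i by (simp add: of_nat_diff)
    then show "- x \<in> H" using mem by simp
    fix y assume "y \<in> H"
    then obtain j where "y = of_nat j" by (auto simp: H_def)
    with i show "x + y \<in> H" using mem[of "i + j"] by simp
  qed
  moreover have "H \<noteq> {0}" using mem[of 1] by auto
  moreover have "finite H" by (simp add: H_def)
  moreover have "card H = ?p" unfolding H_def using inj[of 1] by (simp add: card_image)
  ultimately show "min_subgroup_order TYPE('a) \<le> enat ?p"
    unfolding min_subgroup_order_def by (intro INF_lower2[of H]) auto
qed

section \<open>Signed sums\<close>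

lemma finite_signed_sumset:
  assumes "finite A"
  shows "finite (signed_sumset h A)"
proof (rule finite_subset)
  show "signed_sumset h A \<subseteq> (\<lambda>c. \<Sum>a\<in>A. of_int (c a) * a) ` (A \<rightarrow>\<^sub>E {- int h..int h})"
  proof
    fix s assume "s \<in> signed_sumset h A"
    then obtain c where c: "s = (\<Sum>a\<in>A. of_int (c a) * a)" "\<forall>a\<in>A. c a \<in> {- int h..int h}"
      by (auto simp: signed_sumset_def)
    have "s = (\<Sum>a\<in>A. of_int (restrict c A a) * a)"
      unfolding c(1) by (rule sum.cong) simp_all
    moreover have "restrict c A \<in> A \<rightarrow>\<^sub>E {- int h..int h}" using c(2) by (simp add: restrict_PiE_iff)
    ultimately show "s \<in> (\<lambda>c. \<Sum>a\<in>A. of_int (c a) * a) ` (A \<rightarrow>\<^sub>E {- int h..int h})"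
      by (rule image_eqI)
  qed
qed (use assms in \<open>auto intro!: finite_PiE\<close>)

text \<open>Each term is \<open>e \<cdot> a\<close> with \<open>e = \<plusminus>1\<close> and \<open>a \<in> A\<close>. Terms with the same \<open>a\<close> have the same sign, as they are not
  opposite, so the absolute values of the coefficients count the terms and add up to 4.\<close>

lemma noncancelling_sums_subset_signed_sumset:
  fixes A :: "'a::field set"
  assumes fin: "finite A" and X: "X \<subseteq> A \<union> uminus ` A"
  shows "noncancelling_sums X \<subseteq> signed_sumset 4 A"
proof
  fix s assume "s \<in> noncancelling_sums X"
  then obtain x1 x2 x3 x4 where x: "x1 \<in> X" "x2 \<in> X" "x3 \<in> X" "x4 \<in> X"
      "pair_prod x1 x2 x3 x4 \<noteq> 0" and s: "s = x1 + x2 + x3 + x4"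
    by (auto simp: noncancelling_sums_def)
  have dec: "\<exists>a e. a \<in> A \<and> (e = 1 \<or> e = - 1) \<and> x = of_int e * a" if x: "x \<in> X" for x
  proof (cases "x \<in> A")
    case True
    then show ?thesis by (intro exI[of _ x] exI[of _ 1]) simp
  next
    case False
    with x X obtain a where "a \<in> A" "x = - a" by auto
    then show ?thesis by (intro exI[of _ a] exI[of _ "-1"]) simp
  qed
  obtain a1 e1 where 1: "a1 \<in> A" "e1 = 1 \<or> e1 = - 1" "x1 = of_int e1 * a1" using dec[OF x(1)] by blast
  obtain a2 e2 where 2: "a2 \<in> A" "e2 = 1 \<or> e2 = - 1" "x2 = of_int e2 * a2" using dec[OF x(2)] by blast
  obtain a3 e3 where 3: "a3 \<in> A" "e3 = 1 \<or> e3 = - 1" "x3 = of_int e3 * a3" using dec[OF x(3)] by blast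
  obtain a4 e4 where 4: "a4 \<in> A" "e4 = 1 \<or> e4 = - 1" "x4 = of_int e4 * a4" using dec[OF x(4)] by blast
  have same: "a1 = a2 \<longrightarrow> e1 = e2" "a1 = a3 \<longrightarrow> e1 = e3" "a1 = a4 \<longrightarrow> e1 = e4"
    "a2 = a3 \<longrightarrow> e2 = e3" "a2 = a4 \<longrightarrow> e2 = e4" "a3 = a4 \<longrightarrow> e3 = e4"
  proof -
    have opp: "a = b \<longrightarrow> e = f" if "of_int e * a + of_int f * b \<noteq> 0" "e = 1 \<or> e = - 1" "f = 1 \<or> f = - 1"
      for a b :: 'a and e f :: int
      using that by auto
    have "x1 + x2 \<noteq> 0" "x1 + x3 \<noteq> 0" "x1 + x4 \<noteq> 0" "x2 + x3 \<noteq> 0" "x2 + x4 \<noteq> 0" "x3 + x4 \<noteq> 0"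
      using x(5) unfolding pair_prod_def by (simp_all only: mult_eq_0_iff de_Morgan_disj simp_thms)
    note ne = this[unfolded 1(3) 2(3) 3(3) 4(3)]
    show "a1 = a2 \<longrightarrow> e1 = e2" by (rule opp[OF ne(1) 1(2) 2(2)])
    show "a1 = a3 \<longrightarrow> e1 = e3" by (rule opp[OF ne(2) 1(2) 3(2)])
    show "a1 = a4 \<longrightarrow> e1 = e4" by (rule opp[OF ne(3) 1(2) 4(2)])
    show "a2 = a3 \<longrightarrow> e2 = e3" by (rule opp[OF ne(4) 2(2) 3(2)])
    show "a2 = a4 \<longrightarrow> e2 = e4" by (rule opp[OF ne(5) 2(2) 4(2)])
    show "a3 = a4 \<longrightarrow> e3 = e4" by (rule opp[OF ne(6) 3(2) 4(2)])
  qed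
  define \<sigma> where "\<sigma> a = (if a = a1 then e1 else if a = a2 then e2 else if a = a3 then e3 else e4)" for a
  have \<sigma>: "\<sigma> a1 = e1" "\<sigma> a2 = e2" "\<sigma> a3 = e3" "\<sigma> a4 = e4"
    using same by (simp_all add: \<sigma>_def)
  have \<sigma>_abs: "\<bar>\<sigma> a\<bar> = 1" for a using 1(2) 2(2) 3(2) 4(2) by (auto simp: \<sigma>_def)
  define N :: "'a \<Rightarrow> int" where "N a = (if a1 = a then 1 else 0) + (if a2 = a then 1 else 0) +
    (if a3 = a then 1 else 0) + (if a4 = a then 1 else 0)" for a
  define c where "c a = \<sigma> a * N a" for a
  have N: "0 \<le> N a" "N a \<le> 4" for a by (simp_all add: N_def)
  have abs: "\<bar>c a\<bar> = N a" for a using N(1)[of a] by (simp add: c_def abs_mult \<sigma>_abs)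
  have "(\<Sum>a\<in>A. \<bar>c a\<bar>) = 4"
    unfolding abs N_def sum.distrib using fin 1(1) 2(1) 3(1) 4(1) by simp
  moreover have "c a \<in> {- int 4..int 4}" for a
  proof -
    have "\<bar>c a\<bar> \<le> 4" unfolding abs by (rule N(2))
    then show ?thesis by (simp add: abs_le_iff)
  qed
  moreover have "(\<Sum>a\<in>A. of_int (c a) * a) = s"
  proof -
    have *: "of_int (\<sigma> a * (if b = a then 1 else 0)) * a = (if b = a then of_int (\<sigma> b) * b else 0)" for a b
      by simp
    have "of_int (c a) * a = (if a1 = a then x1 else 0) + (if a2 = a then x2 else 0) +
      (if a3 = a then x3 else 0) + (if a4 = a then x4 else 0)" for a
      unfolding c_def N_def distrib_left of_int_add distrib_right * \<sigma> 1(3) 2(3) 3(3) 4(3) ..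
    then show ?thesis unfolding s using fin 1(1) 2(1) 3(1) 4(1) by (simp only: sum.distrib sum.delta' sum.delta if_True)
  qed
  ultimately show "s \<in> signed_sumset 4 A"
    unfolding signed_sumset_def by (intro CollectI exI[of _ c] conjI ballI) simp_all
qed

section \<open>The lower bounds\<close>

lemma card_signed_sumset_generic:
  fixes A :: "'a::field set"
  assumes "finite A" "X \<subseteq> A \<union> uminus ` A" "card X = m" "3 \<le> m"
    and "CHAR('a) = 0 \<or> 4 * m - 10 < CHAR('a)" "\<not> CHAR('a) dvd 8 * (m - 2)\<^sup>2 - 1"
  shows "4 * m - 9 \<le> card (signed_sumset 4 A)"
proof -
  have "finite X" using assms(1,2) finite_subset by blast
  then interpret nodes X "m - 1" by unfold_locales (use assms in auto)
  have "1 \<le> 8 * (m - 2)\<^sup>2" using assms(4) by (simp add: Suc_le_eq)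
  moreover have "of_nat (8 * (m - 2)\<^sup>2 - 1) \<noteq> (0::'a)" using assms(6) by (simp only: of_nat_eq_0_iff_char_dvd not_False_eq_True)
  ultimately have "8 * (of_nat (m - 1) - 1)\<^sup>2 \<noteq> (1::'a)" using assms(4) by (simp add: of_nat_diff)
  moreover have "char_above TYPE('a) (4 * (m - 1) - 6)"
    unfolding char_above_def of_nat_eq_0_iff_char_dvd
  proof (intro allI impI notI)
    fix i assume i: "0 < i \<and> i \<le> 4 * (m - 1) - 6" and "CHAR('a) dvd i"
    then have "CHAR('a) \<noteq> 0" "CHAR('a) \<le> i" by (auto intro: dvd_imp_le)
    with i assms(4,5) show False by linarith
  qed
  ultimately have "4 * (m - 1) - 5 \<le> card (noncancelling_sums X)"
    using assms(4) by (intro card_noncancelling_sums_generic) auto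
  also have "\<dots> \<le> card (signed_sumset 4 A)"
    by (rule card_mono[OF finite_signed_sumset[OF assms(1)] noncancelling_sums_subset_signed_sumset[OF assms(1,2)]])
  finally show ?thesis using assms(4) by simp
qed

lemma card_symmetrization:
  fixes A :: "'a::field set"
  assumes "finite A" "A \<inter> uminus ` A = {}"
  shows "card (A \<union> uminus ` A) = 2 * card A"
  using assms by (subst card_Un_disjoint) (auto simp: card_image)

text \<open>The values \<open>n = k - 1 = 1\<close> and \<open>p dvd 32 n\<^sup>2 - 1 = 31\<close> would force \<open>p = 31\<close>, which \<open>p \<noteq> 32 (k - 1)\<^sup>2 - 1\<close>
  excludes; hence \<open>n \<ge> 2\<close> in the exceptional case.\<close>

lemma card_signed_sumset_full:
  fixes A :: "'a::field set"
  assumes A: "finite A" "card A = k" "2 \<le> k" "A \<inter> uminus ` A = {}"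
    and p: "CHAR('a) = 0 \<or> 8 * k - 10 < CHAR('a) \<and> CHAR('a) \<noteq> 32 * (k - 1)\<^sup>2 - 1"
  shows "8 * k - 9 \<le> card (signed_sumset 4 A)"
proof (cases "CHAR('a) dvd 8 * (2 * k - 2)\<^sup>2 - 1")
  case False
  then show ?thesis
    using card_signed_sumset_generic[OF A(1) subset_refl card_symmetrization[OF A(1,4)]] p A(2,3)
    by auto
next
  case True
  define n where "n = k - 1"
  have e: "8 * (2 * k - 2)\<^sup>2 = 32 * n\<^sup>2" unfolding n_def by (simp add: power2_eq_square algebra_simps)
  have k: "k = n + 1" "1 \<le> n" using A(3) by (auto simp: n_def)
  have dvd: "CHAR('a) dvd 32 * n\<^sup>2 - 1" using True unfolding e .
  have "n * n \<ge> 1" using k(2) by simp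
  then have "32 * (n * n) > 1" by linarith
  then have "32 * n\<^sup>2 - 1 \<noteq> 0" by (simp add: power2_eq_square)
  then have p0: "CHAR('a) > 0" using dvd by (cases "CHAR('a) = 0") auto
  have pr: "prime CHAR('a)" using p0 by (rule prime_CHAR_semidom)
  have p': "8 * k - 10 < CHAR('a)" "CHAR('a) \<noteq> 32 * n\<^sup>2 - 1" using p p0 by (auto simp: n_def)
  have "n \<noteq> 1"
  proof
    assume "n = 1"
    with dvd have "CHAR('a) dvd 31" by simp
    moreover have "prime (31::nat)" by simp
    ultimately have "CHAR('a) = 31" using pr primes_dvd_imp_eq by blast
    with p'(2) \<open>n = 1\<close> show False by simp
  qed
  with k have n2: "2 \<le> n" by simp
  let ?B = "A \<union> uminus ` A"
  interpret nodes ?B "2 * n + 1"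
    by unfold_locales (use A(1) card_symmetrization[OF A(1,4)] A(2) k in auto)
  have "8 * n - 1 \<le> card (noncancelling_sums ?B)"
  proof (rule card_noncancelling_sums_residual[OF refl n2 pr _ dvd])
    show "8 * n - 2 < CHAR('a)" using p'(1) k by simp
    show "uminus ` ?B = ?B" by (auto simp: image_Un image_image)
    have "0 \<notin> A"
    proof
      assume "0 \<in> A"
      then have "0 \<in> A \<inter> uminus ` A" by (auto intro: image_eqI[of _ _ 0])
      with A(4) show False by simp
    qed
    then show "0 \<notin> ?B" by auto
  qed
  also have "\<dots> \<le> card (signed_sumset 4 A)"
    by (rule card_mono[OF finite_signed_sumset[OF A(1)] noncancelling_sums_subset_signed_sumset[OF A(1) subset_refl]])
  finally show ?thesis using k by simp
qed

theorem theorem3p8: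
  fixes A :: "'a::field set" and k :: nat and p :: enat
  assumes "finite A" and "card A = k" and "k \<ge> 2"
    and "A \<inter> uminus ` A = {}"
    and "p = min_subgroup_order TYPE('a)"
  shows
    "(ereal (32 * real k ^ 2 - 64 * real k + 31) < ereal_of_enat p \<or>
      (ereal (8 * real k - 10) < ereal_of_enat p \<and>
       ereal_of_enat p < ereal (32 * real k ^ 2 - 64 * real k + 31)) \<or>
      (ereal (8 * real k - 10) < ereal_of_enat p \<and> pm3_mod8 p)
      \<longrightarrow> int (card (signed_sumset 4 A)) \<ge> 8 * int k - 9)
     \<and>
     (\<forall>l::nat.
        l \<ge> 1 \<and> in_window k l p \<and> (\<forall>m\<ge>1. in_window k m p \<longrightarrow> l \<le> m) \<and> pm3_mod8 p
        \<longrightarrow> int (card (signed_sumset 4 A)) \<ge> 8 * int k - 9 - 4 * int l)"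
proof (cases "CHAR('a) = 0")
  case True
  then have p: "p = \<infinity>" using assms(5) min_subgroup_order_char_0 by simp
  have "8 * k - 9 \<le> card (signed_sumset 4 A)"
    using card_signed_sumset_full[OF assms(1-4)] True by simp
  then show ?thesis by (auto simp: p in_window_def)
next
  case False
  define q where "q = CHAR('a)"
  have q0: "q > 0" using False by (simp add: q_def)
  have pr: "prime q" unfolding q_def by (rule prime_CHAR_semidom) (use False in simp)
  have p: "p = enat q" using assms(5) min_subgroup_order_char_pos False by (simp add: q_def)
  define N where "N = 32 * (k - 1)\<^sup>2 - 1"
  have "1 \<le> 32 * (k - 1)\<^sup>2" using assms(3) by (simp add: Suc_le_eq)
  then have N: "real N = 32 * real k ^ 2 - 64 * real k + 31" "int N = 32 * (int k - 1)\<^sup>2 - 1"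
    using assms(3) by (simp_all add: N_def of_nat_diff power2_eq_square algebra_simps)
  have kN: "8 * real k - 10 \<le> real N"
  proof -
    have "real N - (8 * real k - 10) = 32 * (real k - 2) * real k + (41 - 8 * real k) + 0"
      unfolding N by (simp add: power2_eq_square algebra_simps)
    moreover have "32 * (real k - 2) * real k + (41 - 8 * real k) = (32 * real k - 8) * (real k - 2) + 25"
      by (simp add: algebra_simps)
    moreover have "(32 * real k - 8) * (real k - 2) \<ge> 0" using assms(3) by simp
    ultimately show ?thesis by linarith
  qed
  have pm3: "(int q mod 8 = 3 \<or> int q mod 8 = 5)" if "pm3_mod8 p"
    using that by (auto simp: pm3_mod8_def p cong_def)
  \<comment> \<open>This excludes \<open>q = N\<close> under the congruence condition.\<close>
  have N7: "int N mod 8 = 7"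
  proof -
    have "int N = 7 + 8 * (4 * (int k - 1)\<^sup>2 - 1)" unfolding N by simp
    then show ?thesis by presburger
  qed
  show ?thesis
  proof (intro conjI impI allI, goal_cases)
    case 1
    have N_gt: "real N < real q \<or> 8 * real k - 10 < real q \<and> real q < real N \<or>
        8 * real k - 10 < real q \<and> pm3_mod8 p"
      using 1 unfolding p N(1)[symmetric] by simp
    have "8 * real k - 10 < real q" using N_gt kN by linarith
    then have "8 * k - 10 < q" using assms(3) by linarith
    moreover have "q \<noteq> N"
    proof
      assume "q = N"
      with N_gt have "pm3_mod8 p" by simp
      from pm3[OF this] N7 \<open>q = N\<close> show False by simp
    qed
    ultimately
    have "8 * k - 9 \<le> card (signed_sumset 4 A)"
      using card_signed_sumset_full[OF assms(1-4)] by (simp add: q_def N_def)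
    then show ?case by linarith
  next
    case (2 l)
    then have w: "8 * real k - 10 - 4 * real l < real q" "real q < 8 * real k - 10 - 4 * (real l - 1)"
      by (auto simp: in_window_def p)
    have "pm3_mod8 p" using 2 by blast
    from pm3[OF this] have odd: "odd q" by presburger
    define m where "m = 2 * k - l"
    have "q \<ge> 2" using pr prime_ge_2_nat by blast
    with odd have "q \<ge> 3" by presburger
    then have "3 \<le> real q" by simp
    with w have "real (4 * l + 9) < real (8 * k)" by simp
    then have "4 * l + 9 < 8 * k" by (simp only: of_nat_less_iff)
    then have ml: "l \<le> 2 * k" "3 \<le> m" unfolding m_def by linarith+
    then have m: "int m = 2 * int k - int l" by (simp add: m_def)
    from w have "real_of_int (8 * int k - 10 - 4 * int l) < real_of_int (int q)"
      "real_of_int (int q) < real_of_int (8 * int k - 10 - 4 * (int l - 1))"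
      by simp_all
    then have "8 * int k - 10 - 4 * int l < int q" "int q < 8 * int k - 10 - 4 * (int l - 1)"
      by (simp_all only: of_int_less_iff)
    then have "4 * int m - 10 < int q" "int q < 4 * int m - 6" unfolding m by (simp_all add: right_diff_distrib)
    moreover have "int q \<noteq> 4 * int m - 8"
    proof
      assume "int q = 4 * int m - 8"
      then have "even (int q)" by simp
      with odd show False by simp
    qed
    ultimately have q: "int q = 4 * int m - 9 \<or> int q = 4 * int m - 7" by linarith
    obtain X where X: "X \<subseteq> A \<union> uminus ` A" "card X = m"
      using obtain_subset_with_card_n[of m "A \<union> uminus ` A"] card_symmetrization[OF assms(1,4)] assms(2)
      by (auto simp: m_def)
    have nd: "\<not> q dvd 8 * (m - 2)\<^sup>2 - 1"
    proof
      assume d: "q dvd 8 * (m - 2)\<^sup>2 - 1"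
      have "1 \<le> 8 * (m - 2)\<^sup>2" using ml by (simp add: Suc_le_eq)
      then have "int (8 * (m - 2)\<^sup>2 - 1) = 8 * (int m - 2)\<^sup>2 - 1" using ml by (simp add: of_nat_diff)
      with d have "int q dvd 8 * (int m - 2)\<^sup>2 - 1" by (metis int_dvd_int_iff)
      then have "int q dvd t * int q - 2 * (8 * (int m - 2)\<^sup>2 - 1)" for t
        by (intro dvd_diff[OF dvd_triv_right dvd_mult])
      \<comment> \<open>With \<open>u = 4 (m - 2)\<close>, \<open>q\<close> is \<open>u - 1\<close> or \<open>u + 1\<close>, and \<open>t q = u\<^sup>2 - 1\<close> for the other one as \<open>t\<close>.\<close>
      moreover have "\<exists>t. t * int q - 2 * (8 * (int m - 2)\<^sup>2 - 1) = 1"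
        using q
      proof
        assume e: "int q = 4 * int m - 9"
        show ?thesis unfolding e
          by (rule exI[of _ "4 * int m - 7"]) (simp add: power2_eq_square algebra_simps)
      next
        assume e: "int q = 4 * int m - 7"
        show ?thesis unfolding e
          by (rule exI[of _ "4 * int m - 9"]) (simp add: power2_eq_square algebra_simps)
      qed
      ultimately have "int q dvd 1" by metis
      with pr show False by simp
    qed
    have "4 * m - 9 \<le> card (signed_sumset 4 A)"
    proof (rule card_signed_sumset_generic[OF assms(1) X ml(2)])
      show "CHAR('a) = 0 \<or> 4 * m - 10 < CHAR('a)" using q ml unfolding q_def[symmetric] by linarith
      show "\<not> CHAR('a) dvd 8 * (m - 2)\<^sup>2 - 1" using nd by (simp add: q_def)
    qed
    then show ?case using m by linarith
  qed
qed

end
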